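(* Let $(W,S)$ be a finite Coxeter system, $Q=q_1\cdots q_m$ a non-empty word on $S$, $\rho\in W$, and let $Q_\dashv=q_1\cdots q_{m-1}$. Then the negative sink tree $\mathcal N^*(Q,\rho)$ equals (i) $\mathcal N^*(Q_\dashv,\rho q_m)$ if $m$ appears in none of the facets of $\mathcal{SC}(Q,\rho)$; (ii) $\mathcal N^*(Q_\dashv,\rho)\star m$ if $m$ appears in all the facets of $\mathcal{SC}(Q,\rho)$; (iii) the disjoint union of $\mathcal N^*(Q_\dashv,\rho q_m)$ and $\mathcal N^*(Q_\dashv,\rho)\star m$, with an additional edge from $\mathsf N(Q_\dashv,\rho q_m)$ to $\mathsf N(Q,\rho)=\mathsf N(Q_\dashv,\rho)\cup\{m\}$, otherwise.
   Context: Let $(W,S)$ be a finite Coxeter system with length function $\ell$. For a word $Q=q_1q_2\cdots q_m$ in the letters $S$ and $\rho\in W$, write $[m]=\{1,\dots,m\}$. The subword complex $\mathcal{SC}(Q,\rho)$ is the simplicial complex whose facets are the sets $I\subseteq[m]$ such that the letters of $Q$ at the positions in $[m]\setminus I$, read in increasing order of position, form a reduced expression of $\rho$. Two distinct facets $I,J$ are adjacent if $I\setminus\{i\}=J\setminus\{j\}$ for some $i\in I$, $j\in J$; the flip from $I$ to $J$ is increasing if $i<j$. The increasing flip graph $\mathcal G(Q,\rho)$ is the directed graph whose vertices are the facets and whose edges $I\to J$ are the increasing flips. For an edge $I\to J$ with $I\setminus\{i\}=J\setminus\{j\}$, $i<j$, set $\mathsf n(I\to J)=j$. A path is $\mathsf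 n$-rising if the sequence of $\mathsf n$-labels of its successive edges is strictly increasing. When $\mathcal{SC}(Q,\rho)$ is non-empty, the negative greedy facet $\mathsf N(Q,\rho)$ is the unique sink of $\mathcal G(Q,\rho)$ (equivalently the lexicographically largest facet), and the negative sink tree $\mathcal N^*(Q,\rho)$ is the spanning tree of $\mathcal G(Q,\rho)$, directed towards $\mathsf N(Q,\rho)$, formed by all $\mathsf n$-rising paths from the facets of $\mathcal{SC}(Q,\rho)$ to $\mathsf N(Q,\rho)$ (there is exactly one such path from each facet). When $\mathcal{SC}(Q,\rho)$ has no facets, $\mathcal N^*(Q,\rho)$ is the empty tree. For a directed tree $\mathcal T$ whose vertices are subsets of $\mathbb Z$ and $z\in\mathbb Z$, $\mathcal T\star z$ denotes the tree with a vertex $X\cup\{z\}$ for each vertex $X$ of $\mathcal T$ and an edge $X\cup\{z\}\to Y\cup\{z\}$ for each edge $X\to Y$ of $\mathcal T$. *)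

theory Defs
  imports
    "HOL-Algebra.Group"
    "Graph_Theory.Pair_Digraph"
begin

section \<open>Coxeter systems\<close>

text \<open>
  The value \<open>M s t = 0\<close> encodes \<open>m(s,t) = \<infinity>\<close>; the corresponding braid relator below is then
  the empty word, so it imposes no relation.
\<close>

definition coxeter_matrix :: "'a set \<Rightarrow> ('a \<Rightarrow> 'a \<Rightarrow> nat) \<Rightarrow> bool" where
  "coxeter_matrix S M \<longleftrightarrow>
     (\<forall>s\<in>S. M s s = 1) \<and>
     (\<forall>s\<in>S. \<forall>t\<in>S. s \<noteq> t \<longrightarrow> M s t = M t s \<and> M s t \<noteq> 1)"

text \<open>
  Deletion of one relator \<open>(s t)^m(s,t)\<close>. Since \<open>M s s = 1\<close> includes the relators \<open>s s\<close>, the monoid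
  of words modulo the generated equivalence is the group presented by the generators \<open>S\<close> and
  these relators; no formal inverses are needed.
\<close>

inductive coxeter_step :: "'a set \<Rightarrow> ('a \<Rightarrow> 'a \<Rightarrow> nat) \<Rightarrow> 'a list \<Rightarrow> 'a list \<Rightarrow> bool"
  for S M where
  "\<lbrakk>s \<in> S; t \<in> S; u \<in> lists S; v \<in> lists S\<rbrakk> \<Longrightarrow>
     coxeter_step S M (u @ concat (replicate (M s t) [s, t]) @ v) (u @ v)"

definition word_prod :: "('a, 'b) monoid_scheme \<Rightarrow> 'a list \<Rightarrow> 'a" where
  "word_prod W w = foldr (\<lambda>x y. x \<otimes>\<^bsub>W\<^esub> y) w \<one>\<^bsub>W\<^esub>"

locale coxeter_system = group W for W (structure) +
  fixes S :: "'a set"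
  assumes generators_closed: "S \<subseteq> carrier W"
    and generates: "\<forall>g\<in>carrier W. \<exists>w\<in>lists S. word_prod W w = g"
    and presentation:
      "\<exists>M. coxeter_matrix S M \<and>
           (\<forall>u\<in>lists S. \<forall>v\<in>lists S.
              word_prod W u = word_prod W v \<longleftrightarrow> equivclp (coxeter_step S M) u v)"

locale finite_coxeter_system = coxeter_system +
  assumes finite_group: "finite (carrier W)"

definition cox_length :: "('a, 'b) monoid_scheme \<Rightarrow> 'a set \<Rightarrow> 'a \<Rightarrow> nat" where
  "cox_length W S g = (LEAST n. \<exists>w\<in>lists S. length w = n \<and> word_prod W w = g)"

definition reduced_expression :: "('a, 'b) monoid_scheme \<Rightarrow> 'a set \<Rightarrow> 'a list \<Rightarrow> 'a \<Rightarrow> bool" where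
  "reduced_expression W S w g \<longleftrightarrow>
     w \<in> lists S \<and> word_prod W w = g \<and> length w = cox_length W S g"


section \<open>Subword complexes and increasing flips\<close>

text \<open>
  Positions in a word are numbered from 1, whereas \<^const>\<open>nths\<close> numbers them from 0.
\<close>

definition sc_facets :: "('a, 'b) monoid_scheme \<Rightarrow> 'a set \<Rightarrow> 'a list \<Rightarrow> 'a \<Rightarrow> nat set set" where
  "sc_facets W S Q \<rho> =
     {I. I \<subseteq> {1..length Q} \<and> reduced_expression W S (nths Q {k. Suc k \<notin> I}) \<rho>}"

definition increasing_flip_by :: "nat set \<Rightarrow> nat set \<Rightarrow> nat \<Rightarrow> nat \<Rightarrow> bool" where
  "increasing_flip_by I J i j \<longleftrightarrow> I \<noteq> J \<and> i \<in> I \<and> j \<in> J \<and> I - {i} = J - {j} \<and> i < j"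

definition flip_graph ::
  "('a, 'b) monoid_scheme \<Rightarrow> 'a set \<Rightarrow> 'a list \<Rightarrow> 'a \<Rightarrow> nat set pair_pre_digraph" where
  "flip_graph W S Q \<rho> =
     \<lparr>pverts = sc_facets W S Q \<rho>,
      parcs = {(I, J). I \<in> sc_facets W S Q \<rho> \<and> J \<in> sc_facets W S Q \<rho> \<and>
                       (\<exists>i j. increasing_flip_by I J i j)}\<rparr>"

definition n_label :: "nat set \<times> nat set \<Rightarrow> nat" where
  "n_label e = (THE j. \<exists>i. increasing_flip_by (fst e) (snd e) i j)"

definition n_rising :: "(nat set \<times> nat set) list \<Rightarrow> bool" where
  "n_rising p \<longleftrightarrow> sorted_wrt (<) (map n_label p)"

text \<open>The sink of the increasing flip graph; only meaningful if there is a facet.\<close>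

definition neg_greedy_facet :: "('a, 'b) monoid_scheme \<Rightarrow> 'a set \<Rightarrow> 'a list \<Rightarrow> 'a \<Rightarrow> nat set" where
  "neg_greedy_facet W S Q \<rho> =
     (THE N. N \<in> pverts (flip_graph W S Q \<rho>) \<and> (\<forall>J. (N, J) \<notin> parcs (flip_graph W S Q \<rho>)))"

definition rising_path_to_sink ::
  "('a, 'b) monoid_scheme \<Rightarrow> 'a set \<Rightarrow> 'a list \<Rightarrow> 'a \<Rightarrow> nat set \<Rightarrow> (nat set \<times> nat set) list \<Rightarrow> bool"
where
  "rising_path_to_sink W S Q \<rho> I p \<longleftrightarrow>
     pre_digraph.apath (with_proj (flip_graph W S Q \<rho>)) I p (neg_greedy_facet W S Q \<rho>) \<and>
     n_rising p"

text \<open>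
  The union of all rising paths from facets to the sink. If there is no facet then there is no
  such path, because paths start at a vertex of the flip graph, and the result is the empty graph.
\<close>

definition neg_sink_tree ::
  "('a, 'b) monoid_scheme \<Rightarrow> 'a set \<Rightarrow> 'a list \<Rightarrow> 'a \<Rightarrow> nat set pair_pre_digraph" where
  "neg_sink_tree W S Q \<rho> =
     \<lparr>pverts = \<Union>{set (pawalk_verts I p) | I p. rising_path_to_sink W S Q \<rho> I p},
      parcs = \<Union>{set p | I p. rising_path_to_sink W S Q \<rho> I p}\<rparr>"


section \<open>Operations on digraphs\<close>

definition star :: "'v set pair_pre_digraph \<Rightarrow> 'v \<Rightarrow> 'v set pair_pre_digraph" (infixl "\<star>" 70) where
  "T \<star> z =
     \<lparr>pverts = (\<lambda>X. X \<union> {z}) ` pverts T,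
      parcs = (\<lambda>(X, Y). (X \<union> {z}, Y \<union> {z})) ` parcs T\<rparr>"

definition digraph_union ::
  "'v pair_pre_digraph \<Rightarrow> 'v pair_pre_digraph \<Rightarrow> 'v pair_pre_digraph" where
  "digraph_union T U = \<lparr>pverts = pverts T \<union> pverts U, parcs = parcs T \<union> parcs U\<rparr>"

definition add_edge :: "'v \<times> 'v \<Rightarrow> 'v pair_pre_digraph \<Rightarrow> 'v pair_pre_digraph" where
  "add_edge e T = T\<lparr>parcs := insert e (parcs T)\<rparr>"

end

theory Submission
  imports Defs
begin

text \<open>
  The facets of \<open>SC(Q, \<rho>)\<close> without \<open>m\<close> are those of \<open>SC(Q', \<rho> q)\<close> (when \<open>q\<close> is a right descent of
  \<open>\<rho>\<close>), and those with \<open>m\<close> are \<open>J \<union> {m}\<close> for \<open>J\<close> in \<open>SC(Q', \<rho>)\<close>. Increasing flips never lead from the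
  second kind to the first, and a flip from the first kind to the second has the largest label
  \<open>m\<close>, so it must be the last step of a rising path; hence it ends at \<open>N(Q', \<rho>) \<union> {m}\<close>. Such a flip
  starts at \<open>N(Q', \<rho>) \<union> {i}\<close> for some \<open>i\<close>, and there is exactly one facet of this form, namely
  \<open>N(Q', \<rho> q)\<close>. The latter rests on the exchange condition, which is derived from the
  presentation by counting, modulo 2, the occurrences of each reflection along a word.
\<close>

section \<open>Words, equivalence closures and selected sublists\<close>

lemma word_prod_Nil [simp]: "word_prod W [] = \<one>\<^bsub>W\<^esub>"
  and word_prod_Cons [simp]: "word_prod W (x # w) = x \<otimes>\<^bsub>W\<^esub> word_prod W w"
  by (simp_all add: word_prod_def)

lemma equivclp_invariant:
  assumes "equivclp r x y" and "\<And>x y. r x y \<Longrightarrow> f x = f y"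
  shows "f x = f y"
  using assms(1) by (induction rule: equivclp_induct) (use assms(2) in \<open>auto\<close>)

text \<open>The exchange condition deletes a letter of a word; here that deletion becomes the
  removal of a position from the index set, which is the form that facets need.\<close>

lemma nths_eq_append_Cons_delete:
  "nths xs A = u @ a # v \<Longrightarrow> \<exists>k\<in>A. k < length xs \<and> nths xs (A - {k}) = u @ v"
proof (induction xs arbitrary: A u)
  case Nil
  then show ?case by simp
next
  case (Cons x xs)
  show ?case
  \<comment> \<open>The letter to delete is the head exactly when index 0 is selected and nothing
    precedes the letter; otherwise it lies in the tail, where indices shift by one.\<close>
  proof (cases "0 \<in> A \<and> u = []")
    case True
    then have "nths xs {j. Suc j \<in> A} = v" using Cons.prems by (simp add: nths_Cons)
    then have "nths (x # xs) (A - {0}) = v" by (simp add: nths_Cons)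
    then show ?thesis using True by auto
  next
    case False
    obtain u' where u': "nths xs {j. Suc j \<in> A} = u' @ a # v"
      and u: "u = (if 0 \<in> A then [x] else []) @ u'"
      using Cons.prems False by (cases u) (auto simp: nths_Cons split: if_splits)
    obtain k where k: "Suc k \<in> A" "k < length xs" "nths xs ({j. Suc j \<in> A} - {k}) = u' @ v"
      using Cons.IH[OF u'] by auto
    have "{j. Suc j \<in> A} - {k} = {j. Suc j \<in> A - {Suc k}}" by auto
    then have "nths (x # xs) (A - {Suc k}) = u @ v" using k u by (simp add: nths_Cons)
    then show ?thesis using k by (intro bexI[of _ "Suc k"]) auto
  qed
qed


section \<open>The exchange condition\<close>

context coxeter_system
begin

section \<open>Reflections along a word\<close>

abbreviation len :: "'a \<Rightarrow> nat" where "len \<equiv> cox_length W S"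

text \<open>For a word s_1 ... s_n of generators, the i-th entry is s_1 ... s_(i-1) s_i s_(i-1) ...
  s_1, the reflection whose left multiplication deletes the i-th letter from the product.\<close>

primrec reflections :: "'a list \<Rightarrow> 'a list" where
  "reflections [] = []"
| "reflections (s # w) = s # map (\<lambda>t. s \<otimes> t \<otimes> s) (reflections w)"

lemma gen_carrier [simp]: "s \<in> S \<Longrightarrow> s \<in> carrier W"
  using generators_closed by auto

lemma word_prod_closed [simp]: "w \<in> lists S \<Longrightarrow> word_prod W w \<in> carrier W"
  by (induction w) auto

lemma word_prod_closed' [simp]: "\<forall>x\<in>set w. x \<in> S \<Longrightarrow> word_prod W w \<in> carrier W"
  by (simp add: in_lists_conv_set)

lemma word_prod_append [simp]:
  "u \<in> lists S \<Longrightarrow> v \<in> lists S \<Longrightarrow> word_prod W (u @ v) = word_prod W u \<otimes> word_prod W v"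
  by (induction u) (auto simp: m_assoc)

text \<open>Since \<open>M s s = 1\<close>, the relator of the pair \<open>s, s\<close> is the word
  \<open>[s, s]\<close>.\<close>

lemma gen_square [simp]: "s \<in> S \<Longrightarrow> s \<otimes> s = \<one>"
proof -
  assume s: "s \<in> S"
  obtain M where "coxeter_matrix S M"
    and M: "\<forall>u\<in>lists S. \<forall>v\<in>lists S. word_prod W u = word_prod W v \<longleftrightarrow> equivclp (coxeter_step S M) u v"
    using presentation by blast
  then have "coxeter_step S M [s, s] []"
    using coxeter_step.intros[of s S s "[]" "[]" M] s by (simp add: coxeter_matrix_def)
  then have "equivclp (coxeter_step S M) [s, s] []" by blast
  then have "word_prod W [s, s] = word_prod W []" using M s by force
  then show ?thesis using s by simp
qed

lemma gen_cancel [simp]: "s \<in> S \<Longrightarrow> x \<in> carrier W \<Longrightarrow> s \<otimes> (s \<otimes> x) = x"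
  by (simp flip: m_assoc)

lemma gen_cancel_right [simp]: "s \<in> S \<Longrightarrow> x \<in> carrier W \<Longrightarrow> x \<otimes> s \<otimes> s = x"
  by (simp add: m_assoc)

lemma gen_inv [simp]: "s \<in> S \<Longrightarrow> inv s = s"
  by (simp add: inv_equality)

lemma reflections_closed: "w \<in> lists S \<Longrightarrow> set (reflections w) \<subseteq> carrier W"
  by (induction w) auto

lemma reflections_append:
  assumes "u \<in> lists S" "v \<in> lists S"
  shows "reflections (u @ v) =
    reflections u @ map (\<lambda>t. word_prod W u \<otimes> t \<otimes> inv (word_prod W u)) (reflections v)"
  using assms
proof (induction u)
  case Nil
  then show ?case using reflections_closed[of v] by (auto intro!: map_idI[symmetric])
next
  case (Cons s u)
  have u: "word_prod W u \<in> carrier W" using Cons.prems Cons.hyps by simp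
  have "s \<otimes> (word_prod W u \<otimes> t \<otimes> inv word_prod W u) \<otimes> s =
    s \<otimes> word_prod W u \<otimes> t \<otimes> inv (s \<otimes> word_prod W u)" if "t \<in> set (reflections v)" for t
    using that reflections_closed[of v] Cons.prems Cons.hyps u
    by (auto simp: inv_mult_group m_assoc subset_iff)
  then show ?case using Cons by simp
qed

lemma word_prod_alternating:
  "s \<in> S \<Longrightarrow> t \<in> S \<Longrightarrow> word_prod W (concat (replicate k [s, t])) = (s \<otimes> t) [^] k"
proof (induction k)
  case (Suc k)
  then have "word_prod W (concat (replicate (Suc k) [s, t])) = (s \<otimes> t) \<otimes> (s \<otimes> t) [^] k"
    by (simp add: m_assoc)
  then show ?case using Suc.prems by (simp only: nat_pow_Suc2 m_closed gen_carrier)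
qed simp

lemma alternating_in_lists: "s \<in> S \<Longrightarrow> t \<in> S \<Longrightarrow> concat (replicate k [s, t]) \<in> lists S"
  by (induction k) auto

lemma reflections_alternating:
  assumes "s \<in> S" "t \<in> S"
  shows "reflections (concat (replicate k [s, t])) = map (\<lambda>i. (s \<otimes> t) [^] i \<otimes> s) [0..<2 * k]"
proof (induction k)
  case 0
  then show ?case by simp
next
  case (Suc k)
  have eq: "s \<otimes> (t \<otimes> ((s \<otimes> t) [^] i \<otimes> s) \<otimes> t) \<otimes> s = (s \<otimes> t) [^] Suc (Suc i) \<otimes> s" for i :: nat
  proof -
    have "s \<otimes> (t \<otimes> ((s \<otimes> t) [^] i \<otimes> s) \<otimes> t) \<otimes> s = ((s \<otimes> t) \<otimes> (s \<otimes> t) [^] i) \<otimes> (s \<otimes> t) \<otimes> s"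
      using assms by (simp add: m_assoc)
    also have "(s \<otimes> t) \<otimes> (s \<otimes> t) [^] i = (s \<otimes> t) [^] Suc i"
      using assms by (simp only: nat_pow_Suc2 m_closed gen_carrier)
    finally show ?thesis by simp
  qed
  \<comment> \<open>The exponents 0 and 1 belong to the two new letters in front; conjugation by
    these letters raises every old exponent by 2, which is \<open>eq\<close>.\<close>
  have "[0..<2 * Suc k] = 0 # 1 # map (\<lambda>i. Suc (Suc i)) [0..<2 * k]"
    by (simp add: upt_conv_Cons map_Suc_upt flip: map_map[of Suc Suc, unfolded comp_def])
  then show ?case using assms Suc eq by (simp add: comp_def del: upt_Suc nat_pow_Suc)
qed

text \<open>
  The reflections of a braid relator occur in equal pairs, since \<open>(s t)^m = 1\<close> makes the
  sequence \<open>(s t)^i s\<close> periodic; so a relator does not affect the parities.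
\<close>

lemma count_reflections_parity:
  assumes "u \<in> lists S" "v \<in> lists S" "word_prod W u = word_prod W v"
  shows "even (count_list (reflections u) t) \<longleftrightarrow> even (count_list (reflections v) t)"
    and "even (length u) \<longleftrightarrow> even (length v)"
proof -
  obtain M where
    M: "\<forall>u\<in>lists S. \<forall>v\<in>lists S. word_prod W u = word_prod W v \<longleftrightarrow> equivclp (coxeter_step S M) u v"
    using presentation by blast
  \<comment> \<open>Both parities are paired into one function, so that a single invariance argument
    along the equivalence closure gives both claims.\<close>
  have *: "(even (count_list (reflections x) t), even (length x)) =
    (even (count_list (reflections y) t), even (length y))" if "coxeter_step S M x y" for x y
    using that
  proof cases
    case (1 a b u v)
    define k where "k = M a b"
    define r where "r = concat (replicate k [a, b])"
    have r: "r \<in> lists S" using 1 alternating_in_lists r_def by blast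
    have "coxeter_step S M r []"
      using coxeter_step.intros[of a S b "[]" "[]" M] 1 by (simp add: r_def k_def)
    then have "equivclp (coxeter_step S M) r []" by blast
    then have Pr: "word_prod W r = \<one>" using M r by force
    then have pow: "(a \<otimes> b) [^] k = \<one>" using word_prod_alternating[of a b k] 1 r_def by simp
    define L where "L = map (\<lambda>i. (a \<otimes> b) [^] i \<otimes> a) [0..<k]"
    have "[0..<2 * k] = [0..<k] @ map (\<lambda>i. k + i) [0..<k]"
      by (simp add: mult_2 upt_add_eq_append[of 0 k k] map_add_upt add.commute)
    then have "reflections r = L @ L"
      using reflections_alternating[of a b k] 1 pow
      by (simp add: r_def L_def nat_pow_mult[symmetric])
    \<comment> \<open>The relator has product \<open>\<one>\<close>, so conjugation by it leaves the
      reflections of \<open>v\<close> unchanged.\<close>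
    then have "reflections (r @ v) = L @ L @ reflections v"
      using reflections_append[of r v] r 1 Pr reflections_closed[of v]
      by (auto intro!: map_idI)
    then have "reflections x = reflections u @
        map (\<lambda>t. word_prod W u \<otimes> t \<otimes> inv (word_prod W u)) (L @ L @ reflections v)"
      using reflections_append[of u "r @ v"] r 1 by (auto simp: r_def k_def)
    moreover have "length r = 2 * k" unfolding r_def by (induction k) auto
    ultimately show ?thesis
      using reflections_append[of u v] 1 by (auto simp: r_def k_def)
  qed
  have "equivclp (coxeter_step S M) u v" using M assms by blast
  from equivclp_invariant[where f = "\<lambda>x. (even (count_list (reflections x) t), even (length x))",
    OF this *]
  show "even (count_list (reflections u) t) \<longleftrightarrow> even (count_list (reflections v) t)"
    and "even (length u) \<longleftrightarrow> even (length v)" by auto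
qed

text \<open>If \<open>t\<close> is p a p^-1 for the prefix p before a letter a, then multiplying by
  \<open>t\<close> cancels this letter, as a a = 1. In the induction, \<open>t = s\<close> deletes
  the first letter and any other entry is the conjugate by \<open>s\<close> of a reflection of the
  tail.\<close>

lemma reflection_deletes_letter:
  assumes "w \<in> lists S" "t \<in> set (reflections w)"
  shows "\<exists>u a v. w = u @ a # v \<and> t \<otimes> word_prod W w = word_prod W (u @ v)"
  using assms
proof (induction w arbitrary: t)
  case Nil
  then show ?case by simp
next
  case (Cons s w)
  show ?case
  proof (cases "t = s")
    case True
    then have "s # w = [] @ s # w \<and> t \<otimes> word_prod W (s # w) = word_prod W ([] @ w)"
      using Cons.prems Cons.hyps by simp
    then show ?thesis by blast
  next
    case False
    then obtain t' where t': "t' \<in> set (reflections w)" "t = s \<otimes> t' \<otimes> s"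
      using Cons.prems Cons.hyps by auto
    then obtain u a v where w: "w = u @ a # v" "t' \<otimes> word_prod W w = word_prod W (u @ v)"
      using Cons.IH by blast
    have "t' \<in> carrier W" using t' reflections_closed Cons.prems Cons.hyps by auto
    then have "t \<otimes> word_prod W (s # w) = word_prod W ((s # u) @ v)"
      using t' w Cons.prems Cons.hyps by (simp add: m_assoc del: word_prod_append)
    then show ?thesis using w by (metis append_Cons)
  qed
qed

section \<open>The length function and the exchange condition\<close>

lemma len_le: "w \<in> lists S \<Longrightarrow> len (word_prod W w) \<le> length w"
  unfolding cox_length_def by (rule Least_le) blast

lemma reduced_exists: "x \<in> carrier W \<Longrightarrow> \<exists>w. reduced_expression W S w x"
proof -
  assume "x \<in> carrier W"
  then have "\<exists>n. \<exists>w\<in>lists S. length w = n \<and> word_prod W w = x" using generates by blast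
  from LeastI_ex[OF this] show ?thesis
    unfolding reduced_expression_def cox_length_def by blast
qed

lemma len_parity: "w \<in> lists S \<Longrightarrow> even (len (word_prod W w)) = even (length w)"
  using reduced_exists[of "word_prod W w"] count_reflections_parity(2)[of _ w]
  unfolding reduced_expression_def by (metis word_prod_closed)

text \<open>Appending \<open>q\<close> to a reduced word raises the length by at most one; the same
  bound for \<open>x \<otimes> q\<close> gives the reverse because \<open>q\<close> is an
  involution. Parity excludes equality.\<close>

lemma len_gen_right:
  assumes "x \<in> carrier W" "q \<in> S"
  shows "len (x \<otimes> q) = Suc (len x) \<or> len x = Suc (len (x \<otimes> q))"
proof -
  have *: "len (y \<otimes> q) \<le> Suc (len y) \<and> even (len (y \<otimes> q)) = odd (len y)" if "y \<in> carrier W" for y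
  proof -
    obtain w where "w \<in> lists S" "word_prod W w = y" "length w = len y"
      using reduced_exists \<open>y \<in> carrier W\<close> unfolding reduced_expression_def by metis
    then show ?thesis using len_le[of "w @ [q]"] len_parity[of "w @ [q]"] assms by auto
  qed
  have "len (x \<otimes> q) \<noteq> len x" using *[OF assms(1)] by metis
  then show ?thesis using *[OF assms(1)] *[of "x \<otimes> q"] assms by auto
qed

lemma len_gen_left:
  assumes "x \<in> carrier W" "s \<in> S"
  shows "len (s \<otimes> x) = Suc (len x) \<or> len x = Suc (len (s \<otimes> x))"
proof -
  have *: "len (s \<otimes> y) \<le> Suc (len y) \<and> even (len (s \<otimes> y)) = odd (len y)" if "y \<in> carrier W" for y
  proof -
    obtain w where "w \<in> lists S" "word_prod W w = y" "length w = len y"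
      using reduced_exists \<open>y \<in> carrier W\<close> unfolding reduced_expression_def by metis
    then show ?thesis using len_le[of "s # w"] len_parity[of "s # w"] assms by auto
  qed
  have "len (s \<otimes> x) \<noteq> len x" using *[OF assms(1)] by metis
  then show ?thesis using *[OF assms(1)] *[of "s \<otimes> x"] assms by auto
qed

text \<open>Compare \<open>w\<close> with \<open>s # v\<close>, where \<open>v\<close> is reduced
  for \<open>s \<otimes> word_prod W w\<close>. Both words have the same product, and the reflection
  \<open>s\<close> occurs exactly once along \<open>s # v\<close>. By parity it occurs along
  \<open>w\<close>, where it deletes a letter.\<close>

lemma exchange:
  assumes w: "w \<in> lists S" and s: "s \<in> S"
    and less: "len (s \<otimes> word_prod W w) < len (word_prod W w)"
  shows "\<exists>u a v. w = u @ a # v \<and> s \<otimes> word_prod W w = word_prod W (u @ v)"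
proof -
  let ?x = "word_prod W w"
  obtain v where v: "v \<in> lists S" "word_prod W v = s \<otimes> ?x" "length v = len (s \<otimes> ?x)"
    using reduced_exists[of "s \<otimes> ?x"] w s unfolding reduced_expression_def by auto
  \<comment> \<open>Otherwise \<open>s\<close> would delete a letter of \<open>v\<close>, leaving a
    word for \<open>?x\<close> that is shorter than \<open>len ?x\<close>.\<close>
  have "s \<notin> set (reflections v)"
  proof
    assume "s \<in> set (reflections v)"
    then obtain a b c where abc: "v = a @ b # c" "s \<otimes> word_prod W v = word_prod W (a @ c)"
      using reflection_deletes_letter v by blast
    then have "?x = word_prod W (a @ c)" "a @ c \<in> lists S" using v w s by auto
    then have "len ?x \<le> length (a @ c)" using len_le by metis
    then show False using less abc v by simp
  qed
  moreover have "s \<otimes> t \<otimes> s = s \<longleftrightarrow> t = s" if "t \<in> carrier W" for t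
  proof
    assume eq: "s \<otimes> t \<otimes> s = s"
    have "t = s \<otimes> (s \<otimes> t \<otimes> s) \<otimes> s" using that s by (simp add: m_assoc)
    then show "t = s" using eq s by simp
  qed (use s in simp)
  \<comment> \<open>Conjugation by \<open>s\<close> fixes \<open>s\<close> and is injective, so no
    entry after the head of \<open>reflections (s # v)\<close> equals \<open>s\<close>.\<close>
  ultimately have "s \<notin> set (map (\<lambda>t. s \<otimes> t \<otimes> s) (reflections v))"
    using reflections_closed[OF v(1)] by (auto simp: image_iff) (metis subsetD)
  then have "count_list (reflections (s # v)) s = 1"
    by (simp add: count_list_0_iff)
  moreover have "word_prod W (s # v) = ?x" using v w s by simp
  ultimately have "odd (count_list (reflections w) s)"
    using count_reflections_parity(1)[of "s # v" w s] v w s by simp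
  then have "count_list (reflections w) s \<noteq> 0" by presburger
  then have "s \<in> set (reflections w)" by (simp add: count_list_0_iff)
  then show ?thesis using reflection_deletes_letter w by blast
qed

text \<open>A reduced word of \<open>x \<otimes> q\<close> followed by \<open>q\<close> is a word
  for \<open>x\<close>, and exchange with \<open>s\<close> deletes one of its letters. Deleting a
  letter before the final \<open>q\<close> would make \<open>s\<close> a left descent of
  \<open>x \<otimes> q\<close>, so the deleted letter is \<open>q\<close> itself.\<close>

lemma exchange_last:
  assumes x: "x \<in> carrier W" and s: "s \<in> S" and q: "q \<in> S"
    and "len (x \<otimes> q) < len x" "len (s \<otimes> x) < len x"
    and nless: "\<not> len (s \<otimes> (x \<otimes> q)) < len (x \<otimes> q)"
  shows "s \<otimes> x = x \<otimes> q"
proof -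
  obtain w where w: "w \<in> lists S" "word_prod W w = x \<otimes> q" "length w = len (x \<otimes> q)"
    using reduced_exists[of "x \<otimes> q"] x q unfolding reduced_expression_def by auto
  have x': "word_prod W (w @ [q]) = x" using w q x by simp
  then obtain u a v where uav: "w @ [q] = u @ a # v" "s \<otimes> x = word_prod W (u @ v)"
    using exchange[of "w @ [q]" s] assms w by auto
  show ?thesis
  proof (cases v rule: rev_cases)
    case Nil
    then show ?thesis using uav w by simp
  next
    case (snoc v' b)
    then have v': "w = u @ a # v'" "b = q" using uav by auto
    then have in_S: "u @ v' \<in> lists S" using w by auto
    have "s \<otimes> (x \<otimes> q) = word_prod W (u @ v') \<otimes> q \<otimes> q"
      using uav snoc v' w x s q in_S by (simp add: m_assoc[symmetric])
    then have "s \<otimes> (x \<otimes> q) = word_prod W (u @ v')" using in_S q by (metis gen_cancel_right word_prod_closed)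
    then have "len (s \<otimes> (x \<otimes> q)) \<le> length (u @ v')" using len_le[OF in_S] by simp
    then show ?thesis using nless v' w by simp
  qed
qed

end

section \<open>Sinks of the increasing flip graph\<close>

text \<open>Stated for any family of sets, so that sinks can be compared across words and on the
  part of a complex whose facets contain a fixed position.\<close>

definition is_sink :: "nat set set \<Rightarrow> nat set \<Rightarrow> bool" where
  "is_sink F N \<longleftrightarrow> N \<in> F \<and> (\<forall>J\<in>F. \<nexists>i j. increasing_flip_by N J i j)"

lemma increasing_flip_by_iff:
  "increasing_flip_by I J i j \<longleftrightarrow>
    i < j \<and> (\<exists>K. i \<notin> K \<and> j \<notin> K \<and> I = insert i K \<and> J = insert j K)"
proof
  assume "increasing_flip_by I J i j"
  then show "i < j \<and> (\<exists>K. i \<notin> K \<and> j \<notin> K \<and> I = insert i K \<and> J = insert j K)"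
    unfolding increasing_flip_by_def by (intro conjI exI[of _ "I - {i}"]) auto
qed (auto simp: increasing_flip_by_def)

lemma increasing_flip_by_insert:
  "z \<notin> I \<Longrightarrow> z \<notin> J \<Longrightarrow>
    increasing_flip_by (insert z I) (insert z J) i j \<longleftrightarrow> increasing_flip_by I J i j"
  (is "_ \<Longrightarrow> _ \<Longrightarrow> ?L \<longleftrightarrow> ?R")
proof -
  assume z: "z \<notin> I" "z \<notin> J"
  show "?L \<longleftrightarrow> ?R"
  proof
    assume ?L
    then obtain K where K: "i < j" "i \<notin> K" "j \<notin> K" "insert z I = insert i K" "insert z J = insert j K"
      unfolding increasing_flip_by_iff by blast
    \<comment> \<open>Outside \<open>K\<close>, the element \<open>z\<close> would have to equal
      both \<open>i\<close> and \<open>j\<close>.\<close>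
    then have "z \<in> K" by (metis insertE insertI1 less_irrefl)
    then have "i \<noteq> z" "j \<noteq> z" using K(2,3) by auto
    moreover have "I = insert i K - {z}" "J = insert j K - {z}"
      using z unfolding K(4,5)[symmetric] by simp_all
    ultimately have "I = insert i (K - {z})" "J = insert j (K - {z})"
      by (simp_all add: insert_Diff_if)
    then show ?R unfolding increasing_flip_by_iff
      using K(1,2,3) by (intro conjI exI[of _ "K - {z}"]) auto
  next
    assume ?R
    then obtain K where K: "i < j" "i \<notin> K" "j \<notin> K" "I = insert i K" "J = insert j K"
      unfolding increasing_flip_by_iff by blast
    then show ?L unfolding increasing_flip_by_iff using z
      by (intro conjI exI[of _ "insert z K"]) auto
  qed
qed

lemma increasing_flip_by_Suc:
  "increasing_flip_by (Suc ` I) (Suc ` J) (Suc i) (Suc j) \<longleftrightarrow> increasing_flip_by I J i j"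
proof -
  have "Suc ` I - {Suc i} = Suc ` (I - {i})" for I i by auto
  then show ?thesis unfolding increasing_flip_by_def by (simp add: inj_image_eq_iff inj_image_mem_iff)
qed

lemma ex_increasing_flip_by_Suc:
  "(\<exists>i j. increasing_flip_by (Suc ` I) (Suc ` J) i j) \<longleftrightarrow> (\<exists>i j. increasing_flip_by I J i j)"
proof
  assume "\<exists>i j. increasing_flip_by (Suc ` I) (Suc ` J) i j"
  then obtain i j where ij: "increasing_flip_by (Suc ` I) (Suc ` J) i j" by blast
  then have "i \<in> Suc ` I" "j \<in> Suc ` J" by (simp_all add: increasing_flip_by_def)
  then show "\<exists>i j. increasing_flip_by I J i j" using ij increasing_flip_by_Suc by blast
qed (use increasing_flip_by_Suc in blast)

lemma is_sink_image:
  assumes "\<And>J K. J \<in> F \<Longrightarrow> K \<in> F \<Longrightarrow>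
    (\<exists>i j. increasing_flip_by (h J) (h K) i j) \<longleftrightarrow> (\<exists>i j. increasing_flip_by J K i j)"
  shows "is_sink (h ` F) N \<longleftrightarrow> (\<exists>J. N = h J \<and> is_sink F J)"
proof -
  have "is_sink (h ` F) (h J) \<longleftrightarrow> is_sink F J" if "J \<in> F" for J
    unfolding is_sink_def using that assms[OF that] by blast
  then show ?thesis unfolding is_sink_def[of "h ` F" N] by (auto simp: is_sink_def)
qed

context coxeter_system
begin

section \<open>Facets when a first or a last letter is added\<close>

abbreviation facets :: "'a list \<Rightarrow> 'a \<Rightarrow> nat set set" where "facets \<equiv> sc_facets W S"

lemma reduced_Cons:
  assumes "s \<in> S" "\<rho> \<in> carrier W"
  shows "reduced_expression W S (s # w) \<rho> \<longleftrightarrow>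
    len (s \<otimes> \<rho>) < len \<rho> \<and> reduced_expression W S w (s \<otimes> \<rho>)"
proof
  assume "reduced_expression W S (s # w) \<rho>"
  then have w: "w \<in> lists S" "s \<otimes> word_prod W w = \<rho>" "Suc (length w) = len \<rho>"
    by (auto simp: reduced_expression_def)
  then have eq: "word_prod W w = s \<otimes> \<rho>" using assms by auto
  then have "len (s \<otimes> \<rho>) \<le> length w" using len_le[OF w(1)] by simp
  then show "len (s \<otimes> \<rho>) < len \<rho> \<and> reduced_expression W S w (s \<otimes> \<rho>)"
    using w eq len_gen_left[OF assms(2,1)] by (auto simp: reduced_expression_def)
next
  assume "len (s \<otimes> \<rho>) < len \<rho> \<and> reduced_expression W S w (s \<otimes> \<rho>)"
  then show "reduced_expression W S (s # w) \<rho>"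
    using assms len_gen_left[OF assms(2,1)] by (auto simp: reduced_expression_def)
qed

lemma reduced_snoc:
  assumes "q \<in> S" "\<rho> \<in> carrier W"
  shows "reduced_expression W S (w @ [q]) \<rho> \<longleftrightarrow>
    len (\<rho> \<otimes> q) < len \<rho> \<and> reduced_expression W S w (\<rho> \<otimes> q)"
proof
  assume "reduced_expression W S (w @ [q]) \<rho>"
  then have w: "w \<in> lists S" "word_prod W w \<otimes> q = \<rho>" "Suc (length w) = len \<rho>"
    using assms by (auto simp: reduced_expression_def in_lists_conv_set)
  then have eq: "word_prod W w = \<rho> \<otimes> q" using assms by auto
  then have "len (\<rho> \<otimes> q) \<le> length w" using len_le[OF w(1)] by simp
  then show "len (\<rho> \<otimes> q) < len \<rho> \<and> reduced_expression W S w (\<rho> \<otimes> q)"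
    using w eq len_gen_right[OF assms(2,1)] by (auto simp: reduced_expression_def)
next
  assume "len (\<rho> \<otimes> q) < len \<rho> \<and> reduced_expression W S w (\<rho> \<otimes> q)"
  then show "reduced_expression W S (w @ [q]) \<rho>"
    using assms len_gen_right[OF assms(2,1)] by (auto simp: reduced_expression_def)
qed

lemma facets_subset: "I \<in> facets Q \<rho> \<Longrightarrow> I \<subseteq> {1..length Q}"
  by (simp add: sc_facets_def)

lemma zero_notin_facet: "I \<in> facets Q \<rho> \<Longrightarrow> 0 \<notin> I"
  using facets_subset by fastforce

lemma Suc_image_facet_iff:
  assumes "s \<in> S" "\<rho> \<in> carrier W" "0 \<notin> J"
  shows "Suc ` J \<in> facets (s # Q) \<rho> \<longleftrightarrow> len (s \<otimes> \<rho>) < len \<rho> \<and> J \<in> facets Q (s \<otimes> \<rho>)"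
proof -
  have "Suc ` J \<subseteq> {1..length (s # Q)} \<longleftrightarrow> J \<subseteq> {1..length Q}"
    using assms(3) by (auto simp: subset_iff Suc_le_eq intro!: gr0I)
  moreover have "{j. Suc j \<in> {k. Suc k \<notin> Suc ` J}} = {j. Suc j \<notin> J}" by auto
  ultimately show ?thesis
    using assms(3) reduced_Cons[OF assms(1,2)] by (auto simp: sc_facets_def nths_Cons)
qed

lemma insert_one_facet_iff:
  assumes "0 \<notin> J"
  shows "insert 1 (Suc ` J) \<in> facets (s # Q) \<rho> \<longleftrightarrow> J \<in> facets Q \<rho>"
proof -
  have "insert 1 (Suc ` J) \<subseteq> {1..length (s # Q)} \<longleftrightarrow> J \<subseteq> {1..length Q}"
    using assms by (auto simp: subset_iff Suc_le_eq intro!: gr0I)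
  moreover have "{j. Suc j \<in> {k. Suc k \<notin> insert 1 (Suc ` J)}} = {j. Suc j \<notin> J}" by auto
  ultimately show ?thesis by (auto simp: sc_facets_def nths_Cons)
qed

lemma facet_Cons_cases:
  assumes "I \<in> facets (s # Q) \<rho>" "s \<in> S" "\<rho> \<in> carrier W"
  obtains (skip) J where "J \<in> facets Q \<rho>" "0 \<notin> J" "I = insert 1 (Suc ` J)"
  | (take) J where "J \<in> facets Q (s \<otimes> \<rho>)" "0 \<notin> J" "len (s \<otimes> \<rho>) < len \<rho>" "I = Suc ` J"
proof -
  \<comment> \<open>The remaining positions, shifted down by one; \<open>j \<noteq> 0\<close>
    discards position 1.\<close>
  define J where "J = {j. j \<noteq> 0 \<and> Suc j \<in> I}"
  have 0: "0 \<notin> J" by (simp add: J_def)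
  have "0 \<notin> I" using zero_notin_facet assms by blast
  then have sub: "x \<in> I \<Longrightarrow> x \<noteq> 1 \<Longrightarrow> x \<in> Suc ` J" for x
    unfolding J_def by (cases x) auto
  have sup: "Suc ` J \<subseteq> I" by (auto simp: J_def)
  show thesis
  proof (cases "1 \<in> I")
    case True
    then have "I = insert 1 (Suc ` J)" using sub sup by blast
    then show ?thesis using skip assms insert_one_facet_iff 0 by metis
  next
    case False
    then have "I = Suc ` J" using sub sup by blast
    then show ?thesis
      using take[of J] 0 assms(1) Suc_image_facet_iff[OF assms(2,3) 0, of Q] by simp
  qed
qed

lemma facet_snoc_iff:
  assumes "q \<in> S" "\<rho> \<in> carrier W"
  shows "I \<in> facets (Q @ [q]) \<rho> \<longleftrightarrow>
    (\<exists>J\<in>facets Q \<rho>. I = insert (Suc (length Q)) J) \<or>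
    (len (\<rho> \<otimes> q) < len \<rho> \<and> I \<in> facets Q (\<rho> \<otimes> q))"
proof (cases "Suc (length Q) \<in> I")
  case True
  let ?m = "Suc (length Q)"
  \<comment> \<open>Position \<open>?m\<close> has 0-based index \<open>length Q\<close>, which lies
    beyond \<open>Q\<close>.\<close>
  have eq: "nths Q {k. Suc k \<notin> I - {?m}} = nths Q {k. Suc k \<notin> I}"
    unfolding nths_def by (rule arg_cong[where f = "map fst"], rule filter_cong)
      (auto dest!: set_zip_rightD)
  have "I \<in> facets (Q @ [q]) \<rho> \<longleftrightarrow> I - {?m} \<in> facets Q \<rho>"
    using True eq by (auto simp: sc_facets_def nths_append le_Suc_eq subset_iff)
  moreover have "J = I - {?m}" if "J \<in> facets Q \<rho>" "I = insert ?m J" for J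
    using that facets_subset[of J Q \<rho>] by auto
  moreover have "I = insert ?m (I - {?m})" using True by auto
  moreover have "I \<notin> facets Q (\<rho> \<otimes> q)" using True facets_subset[of I Q "\<rho> \<otimes> q"] by fastforce
  ultimately show ?thesis by metis
next
  case False
  have "I \<subseteq> {1..length (Q @ [q])} \<longleftrightarrow> I \<subseteq> {1..length Q}"
    using False by (auto simp: subset_iff le_Suc_eq)
  moreover have "nths (Q @ [q]) {k. Suc k \<notin> I} = nths Q {k. Suc k \<notin> I} @ [q]"
    using False by (simp add: nths_append)
  ultimately have "I \<in> facets (Q @ [q]) \<rho> \<longleftrightarrow> len (\<rho> \<otimes> q) < len \<rho> \<and> I \<in> facets Q (\<rho> \<otimes> q)"
    unfolding sc_facets_def using reduced_snoc[OF assms] by simp blast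
  then show ?thesis using False by blast
qed

text \<open>The facet leaves a reduced word of \<open>\<rho>\<close>, from which exchange with
  \<open>s\<close> deletes a letter; the position of this letter joins the facet.\<close>

lemma facet_exchange:
  assumes I: "I \<in> facets Q \<rho>" and s: "s \<in> S" and less: "len (s \<otimes> \<rho>) < len \<rho>"
  obtains j where "j \<notin> I" "0 < j" "insert j I \<in> facets Q (s \<otimes> \<rho>)"
proof -
  define A where "A = {k. Suc k \<notin> I}"
  have red: "reduced_expression W S (nths Q A) \<rho>" and sub: "I \<subseteq> {1..length Q}"
    using I by (auto simp: sc_facets_def A_def)
  then have w: "nths Q A \<in> lists S" "word_prod W (nths Q A) = \<rho>" "length (nths Q A) = len \<rho>"
    by (auto simp: reduced_expression_def)
  then have \<rho>: "\<rho> \<in> carrier W" by auto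
  obtain u a v where uav: "nths Q A = u @ a # v" "s \<otimes> \<rho> = word_prod W (u @ v)"
    using exchange[OF w(1) s] less w by auto
  obtain k where k: "k \<in> A" "k < length Q" "nths Q (A - {k}) = u @ v"
    using nths_eq_append_Cons_delete[OF uav(1)] by blast
  have "u @ v \<in> lists S" using w uav by auto
  moreover have "length (u @ v) = len (s \<otimes> \<rho>)"
    using len_gen_left[OF \<rho> s] less w uav by auto
  ultimately have "reduced_expression W S (u @ v) (s \<otimes> \<rho>)"
    using uav by (simp add: reduced_expression_def)
  moreover have "A - {k} = {i. Suc i \<notin> insert (Suc k) I}" by (auto simp: A_def)
  ultimately have "insert (Suc k) I \<in> facets Q (s \<otimes> \<rho>)"
    using k sub by (auto simp: sc_facets_def)
  then show thesis using that[of "Suc k"] k A_def by simp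
qed

text \<open>At a left descent, a facet that skips \<open>s\<close> can be traded for one that reads
  it, by \<open>facet_exchange\<close>. Hence an induction on \<open>Q\<close> may follow the greedy
  choice without losing the existence of facets.\<close>

lemma facets_Cons_nonempty_iff:
  assumes "s \<in> S" "\<rho> \<in> carrier W"
  shows "facets (s # Q) \<rho> \<noteq> {} \<longleftrightarrow>
    (if len (s \<otimes> \<rho>) < len \<rho> then facets Q (s \<otimes> \<rho>) \<noteq> {} else facets Q \<rho> \<noteq> {})"
proof -
  have "facets Q (s \<otimes> \<rho>) \<noteq> {}" if "len (s \<otimes> \<rho>) < len \<rho>" "I \<in> facets (s # Q) \<rho>" for I
    using that(2) assms
  proof (cases rule: facet_Cons_cases)
    case (skip J)
    then show ?thesis using facet_exchange[OF skip(1) assms(1) that(1)] by blast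
  qed auto
  moreover have "facets Q \<rho> \<noteq> {}" if "\<not> len (s \<otimes> \<rho>) < len \<rho>" "I \<in> facets (s # Q) \<rho>" for I
    using that(2) assms by (cases rule: facet_Cons_cases) (use that in auto)
  moreover have "facets (s # Q) \<rho> \<noteq> {}" if "J \<in> facets Q \<rho>" for J
    using insert_one_facet_iff zero_notin_facet that by blast
  moreover have "facets (s # Q) \<rho> \<noteq> {}" if "len (s \<otimes> \<rho>) < len \<rho>" "J \<in> facets Q (s \<otimes> \<rho>)" for J
    using Suc_image_facet_iff[OF assms, of J Q] zero_notin_facet that by blast
  ultimately show ?thesis by (smt (verit) all_not_in_conv)
qed

text \<open>
  If \<open>s\<close> is a left descent of \<open>\<rho>\<close>, a facet containing position 1 is never a sink:
  the exchange condition flips 1 to a later position.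
\<close>

lemma is_sink_Cons_descent:
  assumes s: "s \<in> S" and \<rho>: "\<rho> \<in> carrier W" and less: "len (s \<otimes> \<rho>) < len \<rho>"
  shows "is_sink (facets (s # Q) \<rho>) N \<longleftrightarrow> (\<exists>J. N = Suc ` J \<and> is_sink (facets Q (s \<otimes> \<rho>)) J)"
proof
  assume sink: "is_sink (facets (s # Q) \<rho>) N"
  then have "N \<in> facets (s # Q) \<rho>" by (simp add: is_sink_def)
  then show "\<exists>J. N = Suc ` J \<and> is_sink (facets Q (s \<otimes> \<rho>)) J"
    using s \<rho>
  proof (cases rule: facet_Cons_cases)
    case (skip J)
    obtain j where j: "j \<notin> J" "0 < j" "insert j J \<in> facets Q (s \<otimes> \<rho>)"
      using facet_exchange[OF skip(1) s less] by blast
    have "Suc ` insert j J \<in> facets (s # Q) \<rho>"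
      using Suc_image_facet_iff[OF s \<rho>, of "insert j J" Q] j skip(2) less by auto
    moreover have "increasing_flip_by N (Suc ` insert j J) 1 (Suc j)"
      unfolding increasing_flip_by_iff
      using j skip by (intro conjI exI[of _ "Suc ` J"]) auto
    ultimately show ?thesis using sink by (auto simp: is_sink_def)
  next
    case (take J)
    have "is_sink (facets Q (s \<otimes> \<rho>)) J"
      unfolding is_sink_def
    proof (intro conjI ballI notI)
      fix K assume K: "K \<in> facets Q (s \<otimes> \<rho>)" and "\<exists>i j. increasing_flip_by J K i j"
      then have "\<exists>i j. increasing_flip_by N (Suc ` K) i j"
        using ex_increasing_flip_by_Suc take by simp
      moreover have "Suc ` K \<in> facets (s # Q) \<rho>"
        using Suc_image_facet_iff[OF s \<rho>, of K Q] K less zero_notin_facet by blast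
      ultimately show False using sink by (auto simp: is_sink_def)
    qed (use take in auto)
    then show ?thesis using take by blast
  qed
next
  assume "\<exists>J. N = Suc ` J \<and> is_sink (facets Q (s \<otimes> \<rho>)) J"
  then obtain J where J: "N = Suc ` J" "is_sink (facets Q (s \<otimes> \<rho>)) J" by blast
  then have J0: "J \<in> facets Q (s \<otimes> \<rho>)" by (simp add: is_sink_def)
  show "is_sink (facets (s # Q) \<rho>) N"
    unfolding is_sink_def
  proof (intro conjI ballI notI)
    show "N \<in> facets (s # Q) \<rho>"
      using Suc_image_facet_iff[OF s \<rho>, of J Q] J0 J less zero_notin_facet by blast
    fix K assume "K \<in> facets (s # Q) \<rho>" and flip: "\<exists>i j. increasing_flip_by N K i j"
    from this(1) s \<rho> show False
    proof (cases rule: facet_Cons_cases)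
      case (skip L)
      \<comment> \<open>A flip from \<open>N\<close> to a facet with position 1 has to insert 1, and
        would thus remove 0, which is not a position.\<close>
      obtain i j M where "i < j" "N = insert i M" "K = insert j M"
        using flip unfolding increasing_flip_by_iff by blast
      moreover have "0 \<notin> N" "1 \<notin> N" using J zero_notin_facet[OF J0] by auto
      ultimately have "j = 1" using skip(3) by auto
      then show ?thesis using \<open>i < j\<close> \<open>N = insert i M\<close> \<open>0 \<notin> N\<close> by auto
    next
      case (take L)
      then show ?thesis using flip J ex_increasing_flip_by_Suc by (auto simp: is_sink_def)
    qed
  qed
qed

text \<open>If \<open>s\<close> is not a left descent, no reduced expression of
  \<open>\<rho>\<close> starts with it; position 1 then lies in every facet and takes part in no
  flip.\<close>

lemma is_sink_Cons_ascent:
  assumes s: "s \<in> S" and \<rho>: "\<rho> \<in> carrier W" and nless: "\<not> len (s \<otimes> \<rho>) < len \<rho>"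
  shows "is_sink (facets (s # Q) \<rho>) N \<longleftrightarrow>
    (\<exists>J. N = insert 1 (Suc ` J) \<and> is_sink (facets Q \<rho>) J)"
proof -
  have facets: "facets (s # Q) \<rho> = (\<lambda>J. insert 1 (Suc ` J)) ` facets Q \<rho>"
  proof (intro equalityI subsetI)
    fix I assume "I \<in> facets (s # Q) \<rho>"
    then show "I \<in> (\<lambda>J. insert 1 (Suc ` J)) ` facets Q \<rho>"
      using s \<rho> by (cases rule: facet_Cons_cases) (use nless in auto)
  qed (use insert_one_facet_iff zero_notin_facet in auto)
  have flip: "(\<exists>i j. increasing_flip_by (insert 1 (Suc ` J)) (insert 1 (Suc ` K)) i j) \<longleftrightarrow>
      (\<exists>i j. increasing_flip_by J K i j)" if "J \<in> facets Q \<rho>" "K \<in> facets Q \<rho>" for J K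
  proof -
    have "1 \<notin> Suc ` J" "1 \<notin> Suc ` K" using that zero_notin_facet by fastforce+
    then show ?thesis
      using increasing_flip_by_insert[of 1 "Suc ` J" "Suc ` K"] ex_increasing_flip_by_Suc[of J K]
      by simp
  qed
  show ?thesis unfolding facets by (rule is_sink_image) (rule flip)
qed

lemma unique_sink:
  assumes "Q \<in> lists S" "\<rho> \<in> carrier W" "facets Q \<rho> \<noteq> {}"
  shows "\<exists>!N. is_sink (facets Q \<rho>) N"
  using assms
proof (induction Q arbitrary: \<rho> rule: list.induct)
  case Nil
  then have "facets [] \<rho> = {{}}" by (auto simp: sc_facets_def)
  then show ?case by (auto simp: is_sink_def increasing_flip_by_def)
next
  case (Cons s Q)
  then have s: "s \<in> S" "Q \<in> lists S" by auto
  show ?case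
  proof (cases "len (s \<otimes> \<rho>) < len \<rho>")
    case True
    then have "\<exists>!N. is_sink (facets Q (s \<otimes> \<rho>)) N"
      using Cons.IH[of "s \<otimes> \<rho>"] Cons.prems facets_Cons_nonempty_iff[of s \<rho> Q] s by auto
    then show ?thesis
      unfolding is_sink_Cons_descent[OF s(1) Cons.prems(2) True] by blast
  next
    case False
    then have "\<exists>!N. is_sink (facets Q \<rho>) N"
      using Cons.IH[of \<rho>] Cons.prems facets_Cons_nonempty_iff[of s \<rho> Q] s by auto
    then show ?thesis
      unfolding is_sink_Cons_ascent[OF s(1) Cons.prems(2) False] by blast
  qed
qed

section \<open>The negative greedy facet and its behaviour under a right descent\<close>

abbreviation neg_facet :: "'a list \<Rightarrow> 'a \<Rightarrow> nat set" where
  "neg_facet \<equiv> neg_greedy_facet W S"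

lemma neg_facet_eq_The: "neg_facet Q \<rho> = (THE N. is_sink (facets Q \<rho>) N)"
  unfolding neg_greedy_facet_def
  by (rule arg_cong[where f = The]) (auto simp: is_sink_def flip_graph_def fun_eq_iff)

lemma neg_facetI:
  "Q \<in> lists S \<Longrightarrow> \<rho> \<in> carrier W \<Longrightarrow> is_sink (facets Q \<rho>) N \<Longrightarrow> neg_facet Q \<rho> = N"
  using unique_sink[of Q \<rho>] the1_equality unfolding neg_facet_eq_The
  by (metis empty_iff is_sink_def)

lemma neg_facet_is_sink:
  "Q \<in> lists S \<Longrightarrow> \<rho> \<in> carrier W \<Longrightarrow> facets Q \<rho> \<noteq> {} \<Longrightarrow> is_sink (facets Q \<rho>) (neg_facet Q \<rho>)"
  using unique_sink[of Q \<rho>] unfolding neg_facet_eq_The by (rule theI')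

lemma neg_facet_in_facets:
  "Q \<in> lists S \<Longrightarrow> \<rho> \<in> carrier W \<Longrightarrow> facets Q \<rho> \<noteq> {} \<Longrightarrow> neg_facet Q \<rho> \<in> facets Q \<rho>"
  using neg_facet_is_sink by (auto simp: is_sink_def)

lemma neg_facet_Cons:
  assumes "s \<in> S" "Q \<in> lists S" "\<rho> \<in> carrier W" "facets (s # Q) \<rho> \<noteq> {}"
  shows "neg_facet (s # Q) \<rho> =
    (if len (s \<otimes> \<rho>) < len \<rho> then Suc ` neg_facet Q (s \<otimes> \<rho>) else insert 1 (Suc ` neg_facet Q \<rho>))"
proof (rule neg_facetI)
  show "is_sink (facets (s # Q) \<rho>)
    (if len (s \<otimes> \<rho>) < len \<rho> then Suc ` neg_facet Q (s \<otimes> \<rho>) else insert 1 (Suc ` neg_facet Q \<rho>))"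
  proof (cases "len (s \<otimes> \<rho>) < len \<rho>")
    case True
    then have "is_sink (facets Q (s \<otimes> \<rho>)) (neg_facet Q (s \<otimes> \<rho>))"
      using facets_Cons_nonempty_iff[OF assms(1,3), of Q] assms neg_facet_is_sink[OF assms(2)]
      by simp
    then show ?thesis
      unfolding if_P[OF True] is_sink_Cons_descent[OF assms(1,3) True] by blast
  next
    case False
    then have "is_sink (facets Q \<rho>) (neg_facet Q \<rho>)"
      using facets_Cons_nonempty_iff[OF assms(1,3), of Q] assms neg_facet_is_sink[OF assms(2)]
      by simp
    then show ?thesis
      unfolding if_not_P[OF False] is_sink_Cons_ascent[OF assms(1,3) False] by blast
  qed
qed (use assms in auto)

text \<open>
  The sink is the greedy facet: reading \<open>Q\<close> from the left, a letter is used whenever it is a left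
  descent of the remaining element. Running this for \<open>\<rho>\<close> and for \<open>\<rho> q\<close> in parallel, the remaining
  elements differ by \<open>q\<close> on the right until one letter is used for \<open>\<rho>\<close> only; by the exchange
  condition the remaining elements agree from then on.
\<close>

lemma neg_facet_descent:
  assumes "Q \<in> lists S" "\<rho> \<in> carrier W" "q \<in> S" "len (\<rho> \<otimes> q) < len \<rho>" "facets Q \<rho> \<noteq> {}"
  shows "facets Q (\<rho> \<otimes> q) \<noteq> {} \<and>
    (\<exists>i. i \<notin> neg_facet Q \<rho> \<and> neg_facet Q (\<rho> \<otimes> q) = insert i (neg_facet Q \<rho>))"
  using assms
proof (induction Q arbitrary: \<rho> rule: list.induct)
  case Nil
  \<comment> \<open>A facet over the empty word forces length 0, which contradicts the descent at
    \<open>q\<close>.\<close>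
  then have "reduced_expression W S [] \<rho>" by (auto simp: sc_facets_def)
  then show ?case using Nil by (simp add: reduced_expression_def)
next
  case (Cons s Q)
  then have s: "s \<in> S" and Q: "Q \<in> lists S" and q: "q \<in> S" and \<rho>: "\<rho> \<in> carrier W" by auto
  then have s\<rho>: "s \<otimes> \<rho> \<in> carrier W" and \<rho>q: "\<rho> \<otimes> q \<in> carrier W" by auto
  have assoc: "s \<otimes> (\<rho> \<otimes> q) = s \<otimes> \<rho> \<otimes> q" using s q \<rho> by (simp add: m_assoc)
  note lens = len_gen_left[OF \<rho> s] len_gen_right[OF s\<rho> q]
  note ne\<rho> = Cons.prems(5)
  note ne = facets_Cons_nonempty_iff[OF s, of _ Q] and N = neg_facet_Cons[OF s Q]
  show ?case
  proof (cases "len (s \<otimes> \<rho>) < len \<rho>")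
    case False
    \<comment> \<open>An ascent \<open>s\<close> of \<open>\<rho>\<close> is also an ascent of
      \<open>\<rho> \<otimes> q\<close>, so both runs skip this letter.\<close>
    then have "len (s \<otimes> \<rho>) = Suc (len \<rho>)" using lens(1) by linarith
    then have "len \<rho> \<le> len (s \<otimes> \<rho> \<otimes> q)" using lens(2) by linarith
    then have nless: "\<not> len (s \<otimes> (\<rho> \<otimes> q)) < len (\<rho> \<otimes> q)"
      unfolding assoc using Cons.prems(4) by linarith
    have "facets Q \<rho> \<noteq> {}" using ne[OF \<rho>] False ne\<rho> by simp
    then obtain i where i: "facets Q (\<rho> \<otimes> q) \<noteq> {}" "i \<notin> neg_facet Q \<rho>"
        "neg_facet Q (\<rho> \<otimes> q) = insert i (neg_facet Q \<rho>)"
      using Cons.IH[OF Q \<rho> q Cons.prems(4)] by blast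
    \<comment> \<open>This keeps the shifted position \<open>Suc i\<close> distinct from the
      position 1 that both facets contain.\<close>
    then have "i \<noteq> 0"
      using zero_notin_facet[OF neg_facet_in_facets[OF Q \<rho>q i(1)]] by auto
    have "facets (s # Q) (\<rho> \<otimes> q) \<noteq> {}" using ne[OF \<rho>q] nless i(1) by simp
    moreover from this have "neg_facet (s # Q) (\<rho> \<otimes> q) = insert (Suc i) (neg_facet (s # Q) \<rho>)"
      using N[OF \<rho> ne\<rho>] N[OF \<rho>q] nless False i(3) by (simp add: insert_commute)
    moreover have "Suc i \<notin> neg_facet (s # Q) \<rho>"
      using N[OF \<rho> ne\<rho>] False i(2) \<open>i \<noteq> 0\<close> by (simp add: inj_image_mem_iff)
    ultimately show ?thesis by blast
  next
    case True
    show ?thesis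
    proof (cases "len (s \<otimes> (\<rho> \<otimes> q)) < len (\<rho> \<otimes> q)")
      case less: True
      have "facets Q (s \<otimes> \<rho>) \<noteq> {}" using ne[OF \<rho>] True ne\<rho> by simp
      \<comment> \<open>Both runs read \<open>s\<close>, and each length drops by one, so
        \<open>q\<close> remains a right descent.\<close>
      moreover have "len \<rho> = Suc (len (s \<otimes> \<rho>))" using lens(1) True by linarith
      then have "len (s \<otimes> \<rho> \<otimes> q) < len (s \<otimes> \<rho>)"
        using less Cons.prems(4) unfolding assoc by linarith
      ultimately obtain i where i: "facets Q (s \<otimes> \<rho> \<otimes> q) \<noteq> {}" "i \<notin> neg_facet Q (s \<otimes> \<rho>)"
          "neg_facet Q (s \<otimes> \<rho> \<otimes> q) = insert i (neg_facet Q (s \<otimes> \<rho>))"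
        using Cons.IH[OF Q s\<rho> q] by blast
      have "facets (s # Q) (\<rho> \<otimes> q) \<noteq> {}" using ne[OF \<rho>q] less i(1) assoc by simp
      moreover from this have "neg_facet (s # Q) (\<rho> \<otimes> q) = insert (Suc i) (neg_facet (s # Q) \<rho>)"
        using N[OF \<rho> ne\<rho>] N[OF \<rho>q] less True i(3) assoc by simp
      moreover have "Suc i \<notin> neg_facet (s # Q) \<rho>"
        using N[OF \<rho> ne\<rho>] True i(2) by (simp add: inj_image_mem_iff)
      ultimately show ?thesis by blast
    next
      case nless: False
      then have eq: "s \<otimes> \<rho> = \<rho> \<otimes> q" using exchange_last[OF \<rho> s q Cons.prems(4) True] by blast
      have "facets Q (\<rho> \<otimes> q) \<noteq> {}" using ne[OF \<rho>] True ne\<rho> eq by simp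
      then have 0: "0 \<notin> neg_facet Q (\<rho> \<otimes> q)" and ne': "facets (s # Q) (\<rho> \<otimes> q) \<noteq> {}"
        using zero_notin_facet[OF neg_facet_in_facets[OF Q \<rho>q]] ne[OF \<rho>q] nless by simp_all
      \<comment> \<open>Only the run for \<open>\<rho>\<close> reads \<open>s\<close>; afterwards
        the runs coincide, so position 1 is the extra element.\<close>
      have "1 \<notin> neg_facet (s # Q) \<rho>"
        using N[OF \<rho> ne\<rho>] True eq 0 by (auto simp: image_iff)
      moreover have "neg_facet (s # Q) (\<rho> \<otimes> q) = insert 1 (neg_facet (s # Q) \<rho>)"
        using N[OF \<rho> ne\<rho>] N[OF \<rho>q ne'] nless True eq by simp
      ultimately show ?thesis using ne' by blast
    qed
  qed
qed

text \<open>Adding a position to \<open>I\<close> deletes a letter from a reduced word of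
  \<open>\<rho>\<close> and leaves one of \<open>\<rho> \<otimes> q\<close>. Deleting the first
  letter \<open>s\<close> forces \<open>s \<otimes> \<rho> = \<rho> \<otimes> q\<close>, while
  deleting a later one forces \<open>s\<close> to be a left descent of
  \<open>\<rho> \<otimes> q\<close>; these exclude each other, and induction settles the
  rest.\<close>

lemma facet_cover_unique:
  assumes "Q \<in> lists S" "\<rho> \<in> carrier W" "q \<in> S" "len (\<rho> \<otimes> q) < len \<rho>"
    and "I \<in> facets Q \<rho>" "insert i I \<in> facets Q (\<rho> \<otimes> q)" "insert k I \<in> facets Q (\<rho> \<otimes> q)"
    and "i \<notin> I" "k \<notin> I"
  shows "i = k"
  using assms
proof (induction Q arbitrary: \<rho> I i k rule: list.induct)
  case Nil
  then show ?case by (auto simp: sc_facets_def)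
next
  case (Cons s Q)
  then have s: "s \<in> S" and Q: "Q \<in> lists S" and q: "q \<in> S" and \<rho>: "\<rho> \<in> carrier W" by auto
  then have s\<rho>: "s \<otimes> \<rho> \<in> carrier W" and \<rho>q: "\<rho> \<otimes> q \<in> carrier W" by auto
  have assoc: "s \<otimes> (\<rho> \<otimes> q) = s \<otimes> \<rho> \<otimes> q" using s q \<rho> by (simp add: m_assoc)
  have pos: "i \<noteq> 0" "k \<noteq> 0" using zero_notin_facet[OF Cons.prems(6)] zero_notin_facet[OF Cons.prems(7)] by auto
  from Cons.prems(5) s \<rho> show ?case
  proof (cases rule: facet_Cons_cases)
    case (skip J)
    have *: "\<exists>j. x = Suc j \<and> j \<notin> J \<and> insert j J \<in> facets Q (\<rho> \<otimes> q)"
      if x: "insert x I \<in> facets (s # Q) (\<rho> \<otimes> q)" "x \<notin> I" "x \<noteq> 0" for x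
    proof -
      obtain j where j: "x = Suc j" "j \<noteq> 0" using x skip by (cases x) auto
      then have "insert x I = insert 1 (Suc ` insert j J)" using skip by auto
      then show ?thesis
        using x j skip insert_one_facet_iff[of "insert j J" s Q "\<rho> \<otimes> q"] by auto
    qed
    obtain i' k' where ik: "i = Suc i'" "i' \<notin> J" "insert i' J \<in> facets Q (\<rho> \<otimes> q)"
      "k = Suc k'" "k' \<notin> J" "insert k' J \<in> facets Q (\<rho> \<otimes> q)"
      using *[OF Cons.prems(6,8) pos(1)] *[OF Cons.prems(7,9) pos(2)] by blast
    then show ?thesis using Cons.IH[OF Q \<rho> q Cons.prems(4) skip(1)] by blast
  next
    case (take J)
    have *: "(x = 1 \<and> s \<otimes> \<rho> = \<rho> \<otimes> q) \<or> (\<exists>j. x = Suc j \<and> j \<notin> J \<and> insert j J \<in> facets Q (s \<otimes> \<rho> \<otimes> q)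
         \<and> len (s \<otimes> \<rho> \<otimes> q) < len (\<rho> \<otimes> q))"
      if x: "insert x I \<in> facets (s # Q) (\<rho> \<otimes> q)" "x \<notin> I" "x \<noteq> 0" for x
    proof (cases "x = 1")
      case True
      \<comment> \<open>The letters read outside \<open>J\<close> then have both
        \<open>s \<otimes> \<rho>\<close> and \<open>\<rho> \<otimes> q\<close> as product.\<close>
      then have "J \<in> facets Q (\<rho> \<otimes> q)" using x take insert_one_facet_iff by auto
      then show ?thesis using True take by (auto simp: sc_facets_def reduced_expression_def)
    next
      case False
      then obtain j where j: "x = Suc j" "j \<noteq> 0" using x by (cases x) auto
      then have "insert x I = Suc ` insert j J" using take by auto
      then show ?thesis
        using x j take Suc_image_facet_iff[OF s \<rho>q, of "insert j J" Q] assoc by auto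
    qed
    have "s \<otimes> \<rho> = \<rho> \<otimes> q \<Longrightarrow> s \<otimes> \<rho> \<otimes> q = \<rho>" using q \<rho> by simp
    then have neq: "s \<otimes> \<rho> \<noteq> \<rho> \<otimes> q" if "len (s \<otimes> \<rho> \<otimes> q) < len (\<rho> \<otimes> q)"
      using that Cons.prems(4) by auto
    show ?thesis
    proof (cases "s \<otimes> \<rho> = \<rho> \<otimes> q")
      case True
      then show ?thesis using *[OF Cons.prems(6,8) pos(1)] *[OF Cons.prems(7,9) pos(2)] neq by blast
    next
      case False
      then obtain i' k' where ik: "i = Suc i'" "i' \<notin> J" "insert i' J \<in> facets Q (s \<otimes> \<rho> \<otimes> q)"
        "k = Suc k'" "k' \<notin> J" "insert k' J \<in> facets Q (s \<otimes> \<rho> \<otimes> q)"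
        "len (s \<otimes> \<rho> \<otimes> q) < len (\<rho> \<otimes> q)"
        using *[OF Cons.prems(6,8) pos(1)] *[OF Cons.prems(7,9) pos(2)] by blast
      \<comment> \<open>Here \<open>len (s \<otimes> \<rho>)\<close> is at least
        \<open>len \<rho> - 1\<close>, hence at least
        \<open>len (\<rho> \<otimes> q)\<close>.\<close>
      have "len (s \<otimes> \<rho> \<otimes> q) < len (s \<otimes> \<rho>)"
        using ik(7) Cons.prems(4) len_gen_left[OF \<rho> s] by linarith
      then show ?thesis using Cons.IH[OF Q s\<rho> q _ take(1)] ik by blast
    qed
  qed
qed

end

section \<open>Rising paths\<close>

definition flips :: "nat set set \<Rightarrow> (nat set \<times> nat set) set" where
  "flips F = {(I, J). I \<in> F \<and> J \<in> F \<and> (\<exists>i j. increasing_flip_by I J i j)}"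

text \<open>Recursive form of the rising paths to the sink, with distinct vertices and increasing
  labels tested at each head. Arbitrary \<open>F\<close> and \<open>N\<close> allow the two parts of
  the complex to be treated separately.\<close>

fun rising_path :: "nat set set \<Rightarrow> nat set \<Rightarrow> nat set \<Rightarrow> (nat set \<times> nat set) list \<Rightarrow> bool" where
  "rising_path F N I [] \<longleftrightarrow> I = N \<and> N \<in> F"
| "rising_path F N I (e # p) \<longleftrightarrow> fst e = I \<and> e \<in> flips F \<and> rising_path F N (snd e) p \<and>
     I \<notin> set (pawalk_verts (snd e) p) \<and> (\<forall>e'\<in>set p. n_label e < n_label e')"

definition rising_tree :: "nat set set \<Rightarrow> nat set \<Rightarrow> nat set pair_pre_digraph" where
  "rising_tree F N =
     \<lparr>pverts = \<Union>{set (pawalk_verts I p) | I p. rising_path F N I p},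
      parcs = \<Union>{set p | I p. rising_path F N I p}\<rparr>"

lemma pverts_rising_tree_iff:
    "X \<in> pverts (rising_tree F N) \<longleftrightarrow> (\<exists>I p. rising_path F N I p \<and> X \<in> set (pawalk_verts I p))"
  and parcs_rising_tree_iff:
    "e \<in> parcs (rising_tree F N) \<longleftrightarrow> (\<exists>I p. rising_path F N I p \<and> e \<in> set p)"
  unfolding rising_tree_def by auto

lemma rising_path_to_sink_iff:
  "rising_path_to_sink W S Q \<rho> I p \<longleftrightarrow>
    rising_path (sc_facets W S Q \<rho>) (neg_greedy_facet W S Q \<rho>) I p"
proof -
  have "rising_path F N I p \<longleftrightarrow>
    I \<in> F \<and> set p \<subseteq> flips F \<and> pcas I p N \<and> distinct (pawalk_verts I p) \<and> n_rising p" for F N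
  proof (induction p arbitrary: I)
    case (Cons e p)
    have "e \<in> flips F \<Longrightarrow> fst e \<in> F \<and> snd e \<in> F" by (auto simp: flips_def)
    then show ?case using Cons[of "snd e"] by (auto simp: n_rising_def)
  qed (auto simp: n_rising_def)
  then show ?thesis
    unfolding rising_path_to_sink_def pre_digraph.apath_def pre_digraph.awalk_def
      cas_with_proj_eq awalk_verts_with_proj_eq
    by (auto simp: flip_graph_def flips_def)
qed

lemma neg_sink_tree_eq:
  "neg_sink_tree W S Q \<rho> = rising_tree (sc_facets W S Q \<rho>) (neg_greedy_facet W S Q \<rho>)"
  by (simp add: neg_sink_tree_def rising_tree_def rising_path_to_sink_iff)

lemma rising_path_verts: "rising_path F N I p \<Longrightarrow> set (pawalk_verts I p) \<subseteq> F"
  by (induction p arbitrary: I) (auto simp: flips_def)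

lemma rising_path_arcs: "rising_path F N I p \<Longrightarrow> set p \<subseteq> flips F"
  by (induction p arbitrary: I) auto

lemma pverts_rising_tree: "pverts (rising_tree F N) \<subseteq> F"
  using rising_path_verts pverts_rising_tree_iff by blast

lemma rising_tree_empty: "rising_tree {} N = \<lparr>pverts = {}, parcs = {}\<rparr>"
proof -
  have "\<not> rising_path {} N I p" for I p by (cases p) (auto simp: flips_def)
  then show ?thesis by (simp add: rising_tree_def)
qed

text \<open>The label is the only element of \<open>J - I\<close>, so the definite description is
  well defined.\<close>

lemma n_label_eq:
  assumes "increasing_flip_by I J i j"
  shows "n_label (I, J) = j"
proof -
  have "J - I = {b}" if flip: "increasing_flip_by I J a b" for a b
  proof -
    obtain K where "a < b" "b \<notin> K" "I = insert a K" "J = insert b K"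
      using flip unfolding increasing_flip_by_iff by blast
    then show ?thesis by auto
  qed
  then have unique: "b = j" if "increasing_flip_by I J a b" for a b using assms that by blast
  show ?thesis
    unfolding n_label_def fst_conv snd_conv
    by (rule the_equality) (use assms unique in blast)+
qed

section \<open>Transport of rising trees along maps between families of facets\<close>

locale flip_embedding =
  fixes F :: "nat set set" and h :: "nat set \<Rightarrow> nat set"
  assumes inj: "inj_on h F"
    and flip_iff: "I \<in> F \<Longrightarrow> J \<in> F \<Longrightarrow>
      increasing_flip_by (h I) (h J) i j \<longleftrightarrow> increasing_flip_by I J i j"
begin

lemma pawalk_verts_map: "pawalk_verts (h I) (map (map_prod h h) p) = map h (pawalk_verts I p)"
  by (induction p arbitrary: I) auto

text \<open>Since \<open>flip_iff\<close> keeps the positions \<open>i\<close> and \<open>j\<close>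
  themselves, labels are preserved along with adjacency; injectivity keeps the vertices
  distinct.\<close>

lemma rising_path_map:
  "rising_path F N I p \<Longrightarrow> rising_path (h ` F) (h N) (h I) (map (map_prod h h) p)"
proof (induction p arbitrary: I)
  case (Cons e p)
  have in_F: "fst e' \<in> F \<and> snd e' \<in> F" if "e' \<in> set (e # p)" for e'
    using that rising_path_arcs[OF Cons.prems] by (auto simp: flips_def)
  then have label: "n_label (map_prod h h e') = n_label e'" if "e' \<in> set (e # p)" for e'
    using that flip_iff by (simp add: n_label_def)
  have "set (pawalk_verts (snd e) p) \<subseteq> F" using Cons.prems rising_path_verts[of F N "snd e" p] by simp
  then have "h I \<notin> h ` set (pawalk_verts (snd e) p)"
    using Cons.prems in_F[of e] by (subst inj_on_image_mem_iff[OF inj]) auto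
  moreover have "map_prod h h e \<in> flips (h ` F)"
  proof -
    obtain J K i j where "e = (J, K)" "J \<in> F" "K \<in> F" "increasing_flip_by J K i j"
      using Cons.prems by (auto simp: flips_def)
    moreover from this have "increasing_flip_by (h J) (h K) i j" using flip_iff by blast
    ultimately show ?thesis by (auto simp: flips_def)
  qed
  ultimately show ?case using Cons label by (simp add: pawalk_verts_map)
qed simp

lemma inverse: "flip_embedding (h ` F) (inv_into F h)"
  using inj flip_iff by unfold_locales (auto simp: inj_on_def)

lemma rising_path_image_iff:
  assumes "N \<in> F"
  shows "rising_path (h ` F) (h N) I p \<longleftrightarrow>
    (\<exists>J r. rising_path F N J r \<and> I = h J \<and> p = map (map_prod h h) r)"
proof
  let ?g = "inv_into F h"
  assume path: "rising_path (h ` F) (h N) I p"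
  \<comment> \<open>The path is pulled back along the inverse map, which is an embedding
    too.\<close>
  have "?g ` h ` F = F" using inj by simp
  then have "rising_path F N (?g I) (map (map_prod ?g ?g) p)"
    using flip_embedding.rising_path_map[OF inverse path] inj assms by simp
  moreover have "I \<in> h ` F" using rising_path_verts[OF path] by (cases p) (use path in auto)
  then have "I = h (?g I)" by (simp add: f_inv_into_f)
  moreover have "p = map (map_prod h h) (map (map_prod ?g ?g) p)"
    using rising_path_arcs[OF path]
    by (auto simp: flips_def f_inv_into_f intro!: map_idI[symmetric])
  ultimately show "\<exists>J r. rising_path F N J r \<and> I = h J \<and> p = map (map_prod h h) r" by blast
qed (use rising_path_map in auto)

lemma rising_tree_image:
  assumes "N \<in> F"
  shows "rising_tree (h ` F) (h N) =
    \<lparr>pverts = h ` pverts (rising_tree F N), parcs = map_prod h h ` parcs (rising_tree F N)\<rparr>"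
proof -
  have "{set (pawalk_verts I p) | I p. rising_path (h ` F) (h N) I p} =
      (`) h ` {set (pawalk_verts I p) | I p. rising_path F N I p}"
  proof -
    have "{set (pawalk_verts I p) | I p. rising_path (h ` F) (h N) I p} =
        {set (pawalk_verts (h J) (map (map_prod h h) r)) | J r. rising_path F N J r}"
      unfolding rising_path_image_iff[OF assms] by blast
    then show ?thesis by (simp add: pawalk_verts_map) blast
  qed
  moreover have "{set p | I p. rising_path (h ` F) (h N) I p} =
      (`) (map_prod h h) ` {set p | I p. rising_path F N I p}"
  proof -
    have "{set p | I p. rising_path (h ` F) (h N) I p} =
        {set (map (map_prod h h) r) | J r. rising_path F N J r}"
      unfolding rising_path_image_iff[OF assms] by blast
    then show ?thesis by simp blast
  qed
  ultimately show ?thesis by (simp add: rising_tree_def image_Union)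
qed

end

lemma flip_embedding_insert:
  assumes "\<forall>I\<in>F. m \<notin> I"
  shows "flip_embedding F (insert m)"
  using assms increasing_flip_by_insert
  by unfold_locales (auto simp: inj_on_def insert_ident)

lemma rising_tree_star:
  assumes "\<forall>I\<in>F. m \<notin> I" "N \<in> F"
  shows "rising_tree (insert m ` F) (insert m N) = rising_tree F N \<star> m"
  using flip_embedding.rising_tree_image[OF flip_embedding_insert[OF assms(1)] assms(2)]
  by (simp add: star_def map_prod_def)

section \<open>Gluing the parts without and with the last position\<close>

text \<open>
  A path entering the facets that contain \<open>m\<close> uses the largest possible label \<open>m\<close>, so it is rising
  only if it stops there.
\<close>

lemma rising_path_union_iff:
  assumes A: "\<forall>I\<in>A. I \<subseteq> {..<m}" and B: "\<forall>I\<in>B. I \<subseteq> {..<m}"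
    and N: "N \<in> B" and M: "M \<in> A" "M = insert i N" "i \<notin> N"
    and unique: "\<And>k. insert k N \<in> A \<Longrightarrow> k \<notin> N \<Longrightarrow> k = i"
  shows "rising_path (A \<union> insert m ` B) (insert m N) I p \<longleftrightarrow>
    rising_path (insert m ` B) (insert m N) I p \<or>
    (\<exists>r. p = r @ [(M, insert m N)] \<and> rising_path A M I r)"
proof -
  let ?B = "insert m ` B" and ?N = "insert m N"
  let ?F = "A \<union> ?B"
  have label_A: "n_label e < m" if e_in: "e \<in> flips A" for e
  proof -
    obtain I J a b where e: "e = (I, J)" "J \<in> A" "increasing_flip_by I J a b"
      using e_in by (auto simp: flips_def)
    moreover have "b \<in> J" using e by (simp add: increasing_flip_by_def)
    ultimately show ?thesis using n_label_eq A by auto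
  qed
  have label_B: "n_label e < m" if e_in: "e \<in> flips ?B" for e
  proof -
    obtain I J a b where e: "e = (insert m I, insert m J)" "I \<in> B" "J \<in> B"
        "increasing_flip_by (insert m I) (insert m J) a b"
      using e_in by (auto simp: flips_def)
    moreover have "m \<notin> I" "m \<notin> J" using e B by auto
    then have "increasing_flip_by I J a b" using e increasing_flip_by_insert by blast
    then have "b \<in> J" by (simp add: increasing_flip_by_def)
    ultimately show ?thesis using n_label_eq B by auto
  qed
  \<comment> \<open>Leaving the sets that contain \<open>m\<close> would remove \<open>m\<close> and
    insert a smaller element, so the flip would not be increasing.\<close>
  have stay: "e \<in> flips ?B" if e: "e \<in> flips ?F" "fst e \<in> ?B" for e
  proof -
    obtain I J a b where IJ: "e = (I, J)" "I \<in> ?B" "J \<in> ?F" "increasing_flip_by I J a b"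
      using e by (auto simp: flips_def)
    have "J \<notin> A"
    proof
      assume "J \<in> A"
      then have J: "J \<subseteq> {..<m}" using A by blast
      obtain K where K: "a < b" "I = insert a K" "J = insert b K"
        using IJ(4) unfolding increasing_flip_by_iff by blast
      then have "m \<notin> K" "b < m" using J by auto
      moreover have "m \<in> insert a K" using IJ(2) unfolding K(2)[symmetric] by auto
      ultimately show False using K(1) by simp
    qed
    then show ?thesis using IJ by (auto simp: flips_def)
  qed
  \<comment> \<open>A flip that gains \<open>m\<close> inserts exactly \<open>m\<close>, so its
    source is \<open>J\<close> with one other element added.\<close>
  have cross: "n_label (I, insert m J) = m \<and> (\<exists>k. I = insert k J \<and> k \<notin> J)"
    if e: "(I, insert m J) \<in> flips ?F" "I \<in> A" "J \<in> B" for I J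
  proof -
    obtain a b where flip: "increasing_flip_by I (insert m J) a b"
      using e(1) by (auto simp: flips_def)
    then obtain K where K: "a \<notin> K" "b \<notin> K" "I = insert a K" "insert m J = insert b K"
      unfolding increasing_flip_by_iff by blast
    have m: "m \<notin> I" "m \<notin> J" using e A B by auto
    have "m \<in> insert b K" unfolding K(4)[symmetric] by simp
    then have "b = m" using K(3) m by simp
    then have "J = K" using K(2,4) m insert_ident[of m J K] by simp
    then show ?thesis using K(1,3) \<open>b = m\<close> n_label_eq[OF flip] by blast
  qed
  have verts_snoc: "rising_path G M I r \<Longrightarrow> pawalk_verts I (r @ [(M, J)]) = pawalk_verts I r @ [J]"
    for G I r J by (induction r arbitrary: I) auto
  have "i < m" using M A by auto
  then have "increasing_flip_by M ?N i m"
    using M N B unfolding increasing_flip_by_iff by (intro conjI exI[of _ N]) auto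
  then have edge: "(M, ?N) \<in> flips ?F" and label_edge: "n_label (M, ?N) = m"
    using M N n_label_eq by (auto simp: flips_def)
  have "?N \<notin> A" using A by auto
  show ?thesis
  proof (intro iffI; (elim disjE exE conjE)?)
    assume "rising_path ?F ?N I p"
    then show "rising_path ?B ?N I p \<or> (\<exists>r. p = r @ [(M, ?N)] \<and> rising_path A M I r)"
    proof (induction p arbitrary: I)
      case Nil
      then show ?case using N by simp
    next
      case (Cons e p)
      obtain J where e: "e = (I, J)" using Cons.prems by (cases e) auto
      have flip: "(I, J) \<in> flips ?F" and I: "I \<in> ?F" and p: "rising_path ?F ?N J p"
        using Cons.prems e by (auto simp: flips_def)
      from Cons.IH[OF p] show ?case
      proof
        assume B_path: "rising_path ?B ?N J p"
        show ?thesis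
        proof (cases "I \<in> ?B")
          case True
          then show ?thesis using Cons.prems B_path stay[of e] e by simp
        next
          case False
          then have IA: "I \<in> A" using I by blast
          have "J \<in> ?B" using rising_path_verts[OF B_path] by (cases p) (use B_path in auto)
          then obtain J' where J': "J = insert m J'" "J' \<in> B" by blast
          then have lab: "n_label e = m" and ex: "\<exists>k. I = insert k J' \<and> k \<notin> J'"
            using cross[of I J'] flip IA e by auto
          \<comment> \<open>After the label \<open>m\<close> no step can follow, as all labels
            within \<open>?B\<close> are smaller.\<close>
          have "p = []"
          proof (cases p)
            case (Cons e' p')
            then have "n_label e' < m" using B_path label_B by simp
            then show ?thesis using Cons.prems Cons lab by simp
          qed
          then have "J = ?N" using B_path by simp
          then have "J' = N" using J' N B insert_ident[of m J' N] by auto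
          then have "I = M" using ex unique IA M by blast
          then have "e # p = [] @ [(M, ?N)] \<and> rising_path A M I []"
            using \<open>p = []\<close> \<open>J = ?N\<close> e M by simp
          then show ?thesis by blast
        qed
      next
        assume "\<exists>r. p = r @ [(M, ?N)] \<and> rising_path A M J r"
        then obtain r where r: "p = r @ [(M, ?N)]" "rising_path A M J r" by blast
        have JA: "J \<in> A" using rising_path_verts[OF r(2)] by (cases r) (use r in auto)
        then have "m \<notin> J" using A by auto
        then have "I \<notin> ?B" using stay[OF flip] by (auto simp: flips_def)
        then have "(I, J) \<in> flips A" using I flip JA by (auto simp: flips_def)
        then have "rising_path A M I (e # r)"
          using Cons.prems e r verts_snoc[OF r(2), of ?N] by simp
        then show ?thesis using r by (metis append_Cons)
      qed
    qed
  next
    assume "rising_path ?B ?N I p"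
    then show "rising_path ?F ?N I p"
      by (induction p arbitrary: I) (auto simp: flips_def)
  next
    fix r assume p: "p = r @ [(M, ?N)]" and "rising_path A M I r"
    from this(2) have "rising_path ?F ?N I (r @ [(M, ?N)])"
    proof (induction r arbitrary: I)
      case Nil
      then show ?case using edge N \<open>?N \<notin> A\<close> M by auto
    next
      case (Cons e r)
      then have r: "rising_path A M (snd e) r" by simp
      have "I \<in> A" using Cons.prems by (auto simp: flips_def)
      then have "I \<noteq> ?N" using \<open>?N \<notin> A\<close> by blast
      moreover have "e \<in> flips ?F" using Cons.prems by (auto simp: flips_def)
      moreover have "n_label e < m" using Cons.prems label_A by simp
      ultimately show ?case
        using Cons.IH[OF r] Cons.prems verts_snoc[OF r, of ?N] label_edge by auto
    qed
    then show "rising_path ?F ?N I p" by (simp add: p)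
  qed
qed

lemma rising_tree_union:
  assumes A: "\<forall>I\<in>A. I \<subseteq> {..<m}" and B: "\<forall>I\<in>B. I \<subseteq> {..<m}"
    and N: "N \<in> B" and M: "M \<in> A" "M = insert i N" "i \<notin> N"
    and unique: "\<And>k. insert k N \<in> A \<Longrightarrow> k \<notin> N \<Longrightarrow> k = i"
  shows "rising_tree (A \<union> insert m ` B) (insert m N) =
    add_edge (M, insert m N) (digraph_union (rising_tree A M) (rising_tree (insert m ` B) (insert m N)))"
proof -
  let ?B = "insert m ` B" and ?N = "insert m N"
  have iff: "rising_path (A \<union> ?B) ?N I p \<longleftrightarrow>
      rising_path ?B ?N I p \<or> (\<exists>r. p = r @ [(M, ?N)] \<and> rising_path A M I r)" for I p
    by (rule rising_path_union_iff[OF A B N M]) (rule unique)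
  have verts: "pawalk_verts I (r @ [(M, ?N)]) = pawalk_verts I r @ [?N]"
    if "rising_path A M I r" for I r
    using that by (induction r arbitrary: I) auto
  \<comment> \<open>The empty paths supply the end vertex of a crossing path (\<open>NN\<close>) and
    a path on which the connecting edge occurs (\<open>MM\<close>).\<close>
  have NN: "rising_path ?B ?N ?N []" and MM: "rising_path A M M []" using N M by auto
  have "pverts (rising_tree (A \<union> ?B) ?N) = pverts (rising_tree A M) \<union> pverts (rising_tree ?B ?N)"
    (is "?L = ?R")
  proof (intro equalityI subsetI)
    fix X assume "X \<in> ?L"
    then obtain I p where path: "rising_path (A \<union> ?B) ?N I p" and X: "X \<in> set (pawalk_verts I p)"
      unfolding pverts_rising_tree_iff by blast
    from path consider "rising_path ?B ?N I p" | r where "rising_path A M I r" "p = r @ [(M, ?N)]"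
      using iff by blast
    then show "X \<in> ?R"
    proof cases
      case 1
      then show ?thesis using X unfolding Un_iff pverts_rising_tree_iff by blast
    next
      case (2 r)
      then have "X \<in> set (pawalk_verts I r) \<or> X \<in> set (pawalk_verts ?N [])"
        using X verts by auto
      then show ?thesis using 2(1) NN unfolding Un_iff pverts_rising_tree_iff by blast
    qed
  next
    fix X assume "X \<in> ?R"
    then consider I r where "rising_path A M I r" "X \<in> set (pawalk_verts I r)"
      | I p where "rising_path ?B ?N I p" "X \<in> set (pawalk_verts I p)"
      unfolding Un_iff pverts_rising_tree_iff by blast
    then show "X \<in> ?L"
    proof cases
      case (1 I r)
      then have "rising_path (A \<union> ?B) ?N I (r @ [(M, ?N)])" unfolding iff by blast
      moreover have "X \<in> set (pawalk_verts I (r @ [(M, ?N)]))" using 1 verts by simp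
      ultimately show ?thesis unfolding pverts_rising_tree_iff by blast
    next
      case (2 I p)
      then show ?thesis unfolding pverts_rising_tree_iff iff by blast
    qed
  qed
  moreover have "parcs (rising_tree (A \<union> ?B) ?N) =
    insert (M, ?N) (parcs (rising_tree A M) \<union> parcs (rising_tree ?B ?N))" (is "?L = ?R")
  proof (intro equalityI subsetI)
    fix e assume "e \<in> ?L"
    then obtain I p where path: "rising_path (A \<union> ?B) ?N I p" and e: "e \<in> set p"
      unfolding parcs_rising_tree_iff by blast
    from path consider "rising_path ?B ?N I p" | r where "rising_path A M I r" "p = r @ [(M, ?N)]"
      using iff by blast
    then show "e \<in> ?R"
    proof cases
      case 1
      then show ?thesis using e unfolding insert_iff Un_iff parcs_rising_tree_iff by blast
    next
      case (2 r)
      then have "e = (M, ?N) \<or> e \<in> set r" using e by auto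
      then show ?thesis using 2(1) unfolding insert_iff Un_iff parcs_rising_tree_iff by blast
    qed
  next
    fix e assume "e \<in> ?R"
    then consider "e = (M, ?N)" | I r where "rising_path A M I r" "e \<in> set r"
      | I p where "rising_path ?B ?N I p" "e \<in> set p"
      unfolding insert_iff Un_iff parcs_rising_tree_iff by blast
    then have "\<exists>I p. rising_path (A \<union> ?B) ?N I p \<and> e \<in> set p"
    proof cases
      case 1
      then have "rising_path (A \<union> ?B) ?N M ([] @ [(M, ?N)]) \<and> e \<in> set ([] @ [(M, ?N)])"
        unfolding iff using MM by simp
      then show ?thesis by blast
    next
      case (2 I r)
      then have "rising_path (A \<union> ?B) ?N I (r @ [(M, ?N)]) \<and> e \<in> set (r @ [(M, ?N)])"
        unfolding iff by simp
      then show ?thesis by blast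
    next
      case (3 I p)
      then show ?thesis unfolding iff by blast
    qed
    then show "e \<in> ?L" unfolding parcs_rising_tree_iff .
  qed
  ultimately show ?thesis by (simp add: add_edge_def digraph_union_def)
qed

section \<open>Removing the last letter\<close>

context coxeter_system
begin

text \<open>No increasing flip leads from a set containing \<open>m\<close> to a subset of
  \<open>{..<m}\<close>, so the sink of the part with \<open>m\<close> remains a sink of the whole
  complex.\<close>

lemma neg_facet_star:
  assumes "Q \<in> lists S" "\<rho> \<in> carrier W" "Q' \<in> lists S" "facets Q' \<rho> \<noteq> {}"
    and m: "\<forall>I\<in>facets Q' \<rho>. m \<notin> I"
    and subset: "insert m ` facets Q' \<rho> \<subseteq> facets Q \<rho>"
    and rest: "\<forall>I\<in>facets Q \<rho> - insert m ` facets Q' \<rho>. I \<subseteq> {..<m}"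
  shows "neg_facet Q \<rho> = insert m (neg_facet Q' \<rho>)"
proof (rule neg_facetI)
  let ?N = "insert m (neg_facet Q' \<rho>)"
  have "is_sink (insert m ` facets Q' \<rho>) N \<longleftrightarrow>
      (\<exists>J. N = insert m J \<and> is_sink (facets Q' \<rho>) J)" for N
    using m by (intro is_sink_image) (simp add: increasing_flip_by_insert)
  then have "is_sink (insert m ` facets Q' \<rho>) ?N"
    using neg_facet_is_sink[OF assms(3,2,4)] by blast
  then have N: "?N \<in> insert m ` facets Q' \<rho>"
    and B: "\<forall>J\<in>insert m ` facets Q' \<rho>. \<nexists>i j. increasing_flip_by ?N J i j"
    unfolding is_sink_def by blast+
  have A: "\<not> increasing_flip_by ?N J i j" if "J \<subseteq> {..<m}" for J i j
  proof
    assume "increasing_flip_by ?N J i j"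
    then obtain K where K: "i < j" "?N = insert i K" "J = insert j K"
      unfolding increasing_flip_by_iff by blast
    then have "m \<notin> K" "j < m" using that by auto
    moreover have "m \<in> insert i K" unfolding K(2)[symmetric] by simp
    ultimately show False using K(1) by simp
  qed
  show "is_sink (facets Q \<rho>) ?N"
    unfolding is_sink_def
  proof (intro conjI ballI)
    show "?N \<in> facets Q \<rho>" using N subset by blast
    fix J assume J: "J \<in> facets Q \<rho>"
    show "\<nexists>i j. increasing_flip_by ?N J i j"
    proof (cases "J \<in> insert m ` facets Q' \<rho>")
      case True
      then show ?thesis by (rule bspec[OF B])
    next
      case False
      then have "J \<subseteq> {..<m}" using J rest by simp
      then show ?thesis using A by simp
    qed
  qed
qed (use assms in auto)

end

theorem proposition4p17:
  fixes W (structure) and S :: "'a set" and Q :: "'a list" and \<rho> :: 'a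
  assumes "finite_coxeter_system W S"
    and "Q \<in> lists S" and "Q \<noteq> []"
    and "\<rho> \<in> carrier W"
  defines "m \<equiv> length Q"
    and "q \<equiv> last Q"
    and "Q' \<equiv> butlast Q"
  shows
    "((\<forall>I\<in>sc_facets W S Q \<rho>. m \<notin> I) \<longrightarrow>
        neg_sink_tree W S Q \<rho> = neg_sink_tree W S Q' (\<rho> \<otimes> q)) \<and>
     ((\<forall>I\<in>sc_facets W S Q \<rho>. m \<in> I) \<longrightarrow>
        neg_sink_tree W S Q \<rho> = neg_sink_tree W S Q' \<rho> \<star> m) \<and>
     (\<not> (\<forall>I\<in>sc_facets W S Q \<rho>. m \<notin> I) \<and> \<not> (\<forall>I\<in>sc_facets W S Q \<rho>. m \<in> I) \<longrightarrow>
        pverts (neg_sink_tree W S Q' (\<rho> \<otimes> q)) \<inter> pverts (neg_sink_tree W S Q' \<rho> \<star> m) = {} \<and>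
        neg_greedy_facet W S Q \<rho> = neg_greedy_facet W S Q' \<rho> \<union> {m} \<and>
        neg_sink_tree W S Q \<rho> =
          add_edge (neg_greedy_facet W S Q' (\<rho> \<otimes> q), neg_greedy_facet W S Q \<rho>)
            (digraph_union (neg_sink_tree W S Q' (\<rho> \<otimes> q)) (neg_sink_tree W S Q' \<rho> \<star> m)))"
proof -
  interpret coxeter_system W S
    using assms(1) by (simp add: finite_coxeter_system_def)
  have Q_snoc: "Q = Q' @ [q]" and m: "m = Suc (length Q')"
    using \<open>Q \<noteq> []\<close> by (simp_all add: Q'_def q_def m_def)
  have q: "q \<in> S" and Q': "Q' \<in> lists S" using \<open>Q \<in> lists S\<close> Q_snoc by auto
  have \<rho>: "\<rho> \<in> carrier W" and \<rho>q: "\<rho> \<otimes> q \<in> carrier W" using assms(4) q by auto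
  \<comment> \<open>The facets of \<open>Q\<close> without \<open>m\<close>: they read the last
    letter, which is possible only if \<open>q\<close> is a right descent of
    \<open>\<rho>\<close>.\<close>
  define A where "A = (if len (\<rho> \<otimes> q) < len \<rho> then facets Q' (\<rho> \<otimes> q) else {})"
  let ?B = "facets Q' \<rho>"
  have F: "facets Q \<rho> = A \<union> insert m ` ?B"
    unfolding Q_snoc m A_def using facet_snoc_iff[OF q \<rho>] by auto
  have small: "\<forall>I\<in>facets Q' \<sigma>. I \<subseteq> {..<m}" for \<sigma>
    using facets_subset[of _ Q' \<sigma>] m by (auto simp: subset_iff less_Suc_eq_le)
  then have m_notin: "\<forall>I\<in>facets Q' \<sigma>. m \<notin> I" for \<sigma> by fastforce
  have smallA: "\<forall>I\<in>A. I \<subseteq> {..<m}" using small unfolding A_def by simp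
  have neg: "neg_facet Q \<rho> = insert m (neg_facet Q' \<rho>)" if "?B \<noteq> {}"
  proof (rule neg_facet_star[OF assms(2) \<rho> Q' that m_notin])
    show "insert m ` ?B \<subseteq> facets Q \<rho>" using F by blast
    show "\<forall>I\<in>facets Q \<rho> - insert m ` ?B. I \<subseteq> {..<m}" using F smallA by blast
  qed
  have star: "rising_tree (insert m ` ?B) (insert m (neg_facet Q' \<rho>)) = neg_sink_tree W S Q' \<rho> \<star> m"
    if "?B \<noteq> {}"
    unfolding neg_sink_tree_eq
    using rising_tree_star[OF m_notin neg_facet_in_facets[OF Q' \<rho> that]] .
  have none: "neg_sink_tree W S Q \<rho> = neg_sink_tree W S Q' (\<rho> \<otimes> q)"
    if "\<forall>I\<in>facets Q \<rho>. m \<notin> I"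
  proof -
    have B: "?B = {}" using that F by auto
    show ?thesis
    proof (cases "len (\<rho> \<otimes> q) < len \<rho>")
      case True
      then have "facets Q \<rho> = facets Q' (\<rho> \<otimes> q)" using F B A_def by simp
      then show ?thesis by (simp add: neg_sink_tree_eq neg_facet_eq_The)
    next
      case False
      \<comment> \<open>Here \<open>Q\<close> has no facets for \<open>\<rho>\<close>, and both
        trees must be empty: \<open>q\<close> is a right descent of
        \<open>\<rho> \<otimes> q\<close>, so by \<open>neg_facet_descent\<close> a facet for
        \<open>\<rho> \<otimes> q\<close> would yield one for
        \<open>\<rho> \<otimes> q \<otimes> q = \<rho>\<close>.\<close>
      then have "len (\<rho> \<otimes> q \<otimes> q) < len (\<rho> \<otimes> q)" using len_gen_right[OF \<rho> q] q \<rho> by auto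
      then have "facets Q' (\<rho> \<otimes> q) = {}"
        using neg_facet_descent[OF Q' \<rho>q q] B q \<rho> by auto
      moreover have "facets Q \<rho> = {}" using F B A_def False by simp
      ultimately show ?thesis by (simp add: neg_sink_tree_eq rising_tree_empty)
    qed
  qed
  have all: "neg_sink_tree W S Q \<rho> = neg_sink_tree W S Q' \<rho> \<star> m"
    if "\<forall>I\<in>facets Q \<rho>. m \<in> I"
  proof -
    have "A = {}" using that F smallA by fastforce
    then have F': "facets Q \<rho> = insert m ` ?B" using F by simp
    show ?thesis
    proof (cases "?B = {}")
      case True
      \<comment> \<open>With no facets at all the hypothesis holds vacuously, and both sides are the
        empty tree.\<close>
      then show ?thesis using F' by (simp add: neg_sink_tree_eq rising_tree_empty star_def)
    next
      case False
      then show ?thesis using F' neg star by (simp add: neg_sink_tree_eq)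
    qed
  qed
  have some: "pverts (neg_sink_tree W S Q' (\<rho> \<otimes> q)) \<inter> pverts (neg_sink_tree W S Q' \<rho> \<star> m) = {} \<and>
      neg_facet Q \<rho> = neg_facet Q' \<rho> \<union> {m} \<and>
      neg_sink_tree W S Q \<rho> = add_edge (neg_facet Q' (\<rho> \<otimes> q), neg_facet Q \<rho>)
        (digraph_union (neg_sink_tree W S Q' (\<rho> \<otimes> q)) (neg_sink_tree W S Q' \<rho> \<star> m))"
    if "\<not> (\<forall>I\<in>facets Q \<rho>. m \<notin> I)" "\<not> (\<forall>I\<in>facets Q \<rho>. m \<in> I)"
  proof -
    have "A \<noteq> {}" using that(2) F by auto
    then have desc: "len (\<rho> \<otimes> q) < len \<rho>" and A: "A = facets Q' (\<rho> \<otimes> q)"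
      by (auto simp: A_def split: if_splits)
    have B: "?B \<noteq> {}" using that(1) F smallA by fastforce
    \<comment> \<open>The connecting edge exchanges this \<open>i\<close> for
      \<open>m\<close>.\<close>
    obtain i where i: "i \<notin> neg_facet Q' \<rho>" "neg_facet Q' (\<rho> \<otimes> q) = insert i (neg_facet Q' \<rho>)"
      using neg_facet_descent[OF Q' \<rho> q desc B] by blast
    have NB: "neg_facet Q' \<rho> \<in> ?B" and NA: "neg_facet Q' (\<rho> \<otimes> q) \<in> A"
      using neg_facet_in_facets[OF Q'] \<rho> \<rho>q B \<open>A \<noteq> {}\<close> A by auto
    have "rising_tree (A \<union> insert m ` ?B) (insert m (neg_facet Q' \<rho>)) =
      add_edge (neg_facet Q' (\<rho> \<otimes> q), insert m (neg_facet Q' \<rho>))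
        (digraph_union (rising_tree A (neg_facet Q' (\<rho> \<otimes> q)))
          (rising_tree (insert m ` ?B) (insert m (neg_facet Q' \<rho>))))"
    proof (rule rising_tree_union[OF smallA small NB NA i(2,1)])
      fix k assume "insert k (neg_facet Q' \<rho>) \<in> A" "k \<notin> neg_facet Q' \<rho>"
      then show "k = i"
        using facet_cover_unique[OF Q' \<rho> q desc NB] NA A i by metis
    qed
    then have "neg_sink_tree W S Q \<rho> = add_edge (neg_facet Q' (\<rho> \<otimes> q), neg_facet Q \<rho>)
        (digraph_union (neg_sink_tree W S Q' (\<rho> \<otimes> q)) (neg_sink_tree W S Q' \<rho> \<star> m))"
      unfolding star[OF B] using F A neg[OF B] by (simp add: neg_sink_tree_eq)
    moreover have "m \<notin> X" if "X \<in> pverts (neg_sink_tree W S Q' (\<rho> \<otimes> q))" for X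
      using that pverts_rising_tree m_notin unfolding neg_sink_tree_eq by blast
    then have "pverts (neg_sink_tree W S Q' (\<rho> \<otimes> q)) \<inter> pverts (neg_sink_tree W S Q' \<rho> \<star> m) = {}"
      by (auto simp: star_def)
    ultimately show ?thesis using neg[OF B] by simp
  qed
  show ?thesis using none all some by blast
qed

end
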